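(* Let $\Xi_F(s)=(\varphi^{-s};q)_\infty Z_F(s)$ with $q=-\varphi^{-2}$, where $Z_F$ is the meromorphic continuation of $\sum_{n\ge1}F_n^{-s}$ to $\mathbb C$; $\Xi_F$ is entire. Then $\sum_\rho|\rho|^{-3}<\infty$, where $\rho$ runs over all zeros of $Z_F$ in $\mathbb C$ with multiplicity, and there are constants $A,B,C\in\mathbb C$ such that for all $s\in\mathbb C$ $$\Xi_F(s)=e^{As^2+Bs+C}\prod_\rho\left(1-\frac s\rho\right)\exp\!\left(\frac s\rho+\frac{s^2}{2\rho^2}\right),$$ where $\rho$ runs over all zeros of $Z_F$, with multiplicity.
   Context: $F_1=F_2=1$, $F_{n+2}=F_{n+1}+F_n$ are the Fibonacci numbers, $\varphi=(1+\sqrt5)/2$, and for $|q|<1$, $(a;q)_\infty=\prod_{j=0}^\infty(1-aq^j)$. It is known (Egami, Navas) that $\sum_{n\ge1}F_n^{-s}$ ($\operatorname{Re}s>0$) continues meromorphically to $\mathbb C$ via $$Z_F(s)=5^{s/2}\sum_{k\ge0}\binom{-s}{k}\frac1{\varphi^{s+2k}+(-1)^{k+1}},$$ with simple poles exactly at $-2k+\frac{(2m+k)\pi i}{\log\varphi}$, $k\ge0$, $m\in\mathbb Z$ (in particular $s=0$ is a pole, so every zero satisfies $\rho\ne0$). *)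

theory Defs
  imports "HOL-Complex_Analysis.Complex_Analysis" "HOL-Number_Theory.Fib"
begin

definition golden :: real where
  "golden = (1 + sqrt 5) / 2"

definition qpochhammer_inf :: "complex \<Rightarrow> complex \<Rightarrow> complex" where
  "qpochhammer_inf a q = (\<Prod>j. 1 - a * q ^ j)"

(* The meromorphic continuation is unique as a function because "nicely meromorphic"
   fixes the values at removable singularities (by continuity) and at poles (value 0). *)
definition fib_zeta :: "complex \<Rightarrow> complex" where
  "fib_zeta = (THE Z. Z nicely_meromorphic_on UNIV \<and>
     (\<forall>s. Re s > 0 \<longrightarrow> (\<lambda>n. of_nat (fib (Suc n)) powr (- s)) sums Z s))"

(* A pole of fib_zeta carries the value 0 by convention, so it has to be excluded. *)
definition fib_zeta_zeros :: "complex set" where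
  "fib_zeta_zeros = {\<rho>. fib_zeta \<rho> = 0 \<and> \<not> is_pole fib_zeta \<rho>}"

definition fib_zeta_mult :: "complex \<Rightarrow> nat" where
  "fib_zeta_mult \<rho> = nat (zorder fib_zeta \<rho>)"

(* At the poles of fib_zeta the product is 0 * 0 by convention; its value there is
   the limit. *)
definition fib_Xi :: "complex \<Rightarrow> complex" where
  "fib_Xi = remove_sings (\<lambda>s.
     qpochhammer_inf (of_real golden powr (- s)) (- of_real (1 / golden ^ 2)) * fib_zeta s)"

(* Unconditional convergence of a product over an arbitrary index set, the multiplicative
   counterpart of has_sum: only finitely many factors vanish, and the product of the other
   ones converges to a nonzero limit (as for the sequential has_prod). *)
definition has_prod_over :: "('a \<Rightarrow> complex) \<Rightarrow> complex \<Rightarrow> 'a set \<Rightarrow> bool" where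
  "has_prod_over f P A \<longleftrightarrow> finite {x \<in> A. f x = 0} \<and>
     (\<exists>p. p \<noteq> 0 \<and>
       ((\<lambda>F. \<Prod>x\<in>F. f x) \<longlongrightarrow> p) (finite_subsets_at_top {x \<in> A. f x \<noteq> 0}) \<and>
       P = (\<Prod>x\<in>{x \<in> A. f x = 0}. f x) * p)"

end

(* Write h for f / prod_{|a| < R} (1 - z/a)^(m a), for an entire f with f(0) <> 0 and
   |f(z)| <= exp (K (1 + |z|)^p). On |z| = 2 R every factor 1 - z/a has modulus at least 1, so the
   maximum principle bounds h on the disc |z| <= 2 R by the growth of f, and h has no zeros in
   |z| < R. By Borel-Caratheodory and Cauchy's inequalities, log (h / f(0)) is a polynomial of degree
   at most p up to an error O(R^p (|z| / R)^(p+1)). Absorbing the exponential parts of the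
   Weierstrass factors,
     f(z) = f(0) * prod_{|a| < R} E_p(z/a)^(m a) * exp (D(z) + e_R(z)),   e_R(z) -> 0 as R -> oo.
   Since E_p(u) = 1 + O(u^(p+1)), D is the Taylor polynomial of log (f / f(0)) at 0, so it does
   not depend on R and one can let R tend to infinity pointwise; no lower bound for the
   canonical product is needed.

   For Xi_F the series of Z_F, multiplied termwise by the q-Pochhammer product, gives the bound
   with p = 2. No zero of the product is a zero of Xi_F, because the only surviving term of the
   series there is nonzero, so the zeros of Xi_F are those of Z_F with the same multiplicities. *)

theory Submission
  imports Defs
begin

section \<open>Hadamard factorization for entire functions of finite order\<close>

text \<open>The exponent 2 comes from the q-Pochhammer product. For |s| <= r, its variable w =
  phi^(-s) has |w| <= phi^r, so |w q^j| can exceed 1 only for j < r/2. Each of these O(r) factors is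
  exp(O(r)), and the product of all others is bounded, which gives exp(O(r^2)) in total. The factors
  5^(s/2) and phi^(-s) and the binomial series cost only exp(O(r)), because the absolute binomial
  series sums to (1 - phi^(-2))^(-r). The division by the zeros in |a| < R is used twice: once for
  the growth of the quotient, and once, on a larger circle, to count zeros. The count O(R^p) makes
  the sum of |a|^(-p-1) finite, and this in turn gives convergence of the product of Weierstrass
  factors. The normalization at the origin needs f(0) <> 0. For Xi_F this holds because s = 0 is
  itself a zero of the Pochhammer product, hence a pole of Z_F. Since \<open>fib_zeta\<close> is
  given by a definite description, the series identity on Re s > 0 has to be supplemented by an
  identity theorem that also fixes the values at poles and removable singularities.\<close>

lemma borel_caratheodory_half_radius:
  assumes g: "g holomorphic_on ball 0 R" and "R > 0" and g0: "g 0 = 0"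
    and Re_less: "\<And>z. z \<in> ball 0 R \<Longrightarrow> Re (g z) < M"
    and z: "norm z \<le> R / 2"
  shows "norm (g z) \<le> 2 * M"
proof -
  have M: "M > 0" using Re_less[of 0] \<open>R > 0\<close> g0 by simp
  have closer: "norm (g w) < norm (2 * of_real M - g w)" if w: "w \<in> ball 0 R" for w
  proof -
    have "(Re (g w))\<^sup>2 < (2 * M - Re (g w))\<^sup>2"
      using Re_less[OF w] M by (simp add: power2_eq_square algebra_simps)
    then show ?thesis
      unfolding cmod_def by (simp add: power2_eq_square)
  qed
  have ne: "2 * of_real M - g w \<noteq> 0" if w: "w \<in> ball 0 R" for w
    using closer[OF w] by auto
  \<comment> \<open>The Moebius map u -> u / (2 M - u) sends the half-plane Re u < M into the unit
    disc and fixes 0. The Schwarz lemma at |z| <= R / 2 then yields 2 |g z| <= |2 M - g z| <= 2 M +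
    |g z|.\<close>
  define h where "h = (\<lambda>w. g (of_real R * w) / (2 * of_real M - g (of_real R * w)))"
  have in_ball: "of_real R * w \<in> ball 0 R" if "norm w < 1" for w :: complex
    using that \<open>R > 0\<close> by (simp add: norm_mult)
  have "(g \<circ> (\<lambda>w. of_real R * w)) holomorphic_on ball 0 1"
    using in_ball by (intro holomorphic_on_compose_gen[OF _ g] holomorphic_intros) auto
  then have gR: "(\<lambda>w. g (of_real R * w)) holomorphic_on ball 0 1"
    by (simp add: o_def)
  have hol: "h holomorphic_on ball 0 1"
    unfolding h_def by (intro holomorphic_intros gR) (use ne in_ball in auto)
  have less1: "norm (h w) < 1" if "norm w < 1" for w
    using closer[OF in_ball[OF that]] by (auto simp: h_def norm_divide divide_less_eq)
  have zR: "norm (z / R) \<le> 1 / 2" "norm (z / R) < 1"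
    using z \<open>R > 0\<close> by (auto simp: norm_divide field_simps)
  have "norm (h (z / R)) \<le> 1 / 2"
    using Schwarz_Lemma(1)[OF hol _ less1 zR(2)] zR(1) g0 by (simp add: h_def)
  moreover have "h (z / R) = g z / (2 * of_real M - g z)"
    using \<open>R > 0\<close> by (simp add: h_def)
  moreover have "z \<in> ball 0 R" using z \<open>R > 0\<close> by simp
  ultimately have "norm (g z) \<le> norm (2 * of_real M - g z) / 2"
    using ne by (simp add: norm_divide divide_simps)
  also have "\<dots> \<le> (2 * M + norm (g z)) / 2"
    using norm_triangle_ineq4[of "2 * of_real M" "g z"] M by (simp add: norm_mult)
  finally show ?thesis by simp
qed

text \<open>Cauchy's inequalities bound the k-th Taylor term by B (|z| / r)^k. From index n on, a
  geometric series with ratio at most 1/2 remains, whence the factor 2.\<close>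

lemma taylor_remainder_bound:
  assumes g: "g holomorphic_on ball 0 r" and cont: "continuous_on (cball 0 r) g" and "r > 0"
    and bnd: "\<And>z. norm z \<le> r \<Longrightarrow> norm (g z) \<le> B"
    and z: "norm z \<le> r / 2"
  shows "norm (g z - (\<Sum>k<n. (deriv ^^ k) g 0 / fact k * z ^ k)) \<le> 2 * B * (norm z / r) ^ n"
proof -
  define c where "c = (\<lambda>k. (deriv ^^ k) g 0 / fact k)"
  define x where "x = norm z / r"
  have x: "0 \<le> x" "x \<le> 1 / 2" using z \<open>r > 0\<close> by (auto simp: x_def field_simps)
  have B: "B \<ge> 0" using order_trans[OF norm_ge_zero bnd[of 0]] \<open>r > 0\<close> by simp
  have "(\<lambda>k. (deriv ^^ k) g 0 / fact k * (z - 0) ^ k) sums g z"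
    by (rule holomorphic_power_series[OF g]) (use z \<open>r > 0\<close> in auto)
  then have sums: "(\<lambda>k. c k * z ^ k) sums g z" by (simp add: c_def)
  have coeff_bound: "norm (c k * z ^ k) \<le> B * x ^ k" for k
  proof -
    have "norm ((deriv ^^ k) g 0) \<le> fact k * B / r ^ k"
      by (rule Cauchy_inequality[OF g cont \<open>r > 0\<close>]) (use bnd in auto)
    then have "norm (c k) \<le> B / r ^ k"
      using \<open>r > 0\<close> by (simp add: c_def norm_divide field_simps)
    then have "norm (c k) * norm z ^ k \<le> B / r ^ k * norm z ^ k"
      by (intro mult_right_mono) auto
    then show ?thesis by (simp add: norm_mult norm_power x_def power_divide)
  qed
  have "(\<lambda>k. c (k + n) * z ^ (k + n)) sums (g z - (\<Sum>k<n. c k * z ^ k))"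
    using sums by (rule sums_split_initial_segment)
  moreover have geo: "(\<lambda>k. B * x ^ n * x ^ k) sums (B * x ^ n * (1 / (1 - x)))"
    using x by (intro sums_mult geometric_sums) auto
  ultimately have "norm (g z - (\<Sum>k<n. c k * z ^ k)) \<le> B * x ^ n * (1 / (1 - x))"
  proof -
    assume s: "(\<lambda>k. c (k + n) * z ^ (k + n)) sums (g z - (\<Sum>k<n. c k * z ^ k))"
    have "norm (\<Sum>k. c (k + n) * z ^ (k + n)) \<le> (\<Sum>k. B * x ^ n * x ^ k)"
    proof (rule norm_suminf_le)
      show "norm (c (k + n) * z ^ (k + n)) \<le> B * x ^ n * x ^ k" for k
        using coeff_bound[of "k + n"] by (simp only: power_add mult_ac)
      show "summable (\<lambda>k. B * x ^ n * x ^ k)" using geo by (rule sums_summable)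
    qed
    then show ?thesis using s geo by (simp add: sums_iff)
  qed
  also have "\<dots> \<le> B * x ^ n * 2"
    using x B by (intro mult_left_mono) (auto simp: field_simps)
  finally show ?thesis by (simp add: c_def x_def mult_ac)
qed

section \<open>Unconditional products from absolutely summable deviations from 1\<close>

lemma has_prod_over_powI:
  fixes f :: "'a \<Rightarrow> complex" and m :: "'a \<Rightarrow> nat"
  assumes "(\<lambda>x. real (m x) * norm (f x - 1)) summable_on A"
  obtains P where "has_prod_over (\<lambda>x. f x ^ m x) P A"
    and "\<And>(F :: 'b \<Rightarrow> 'a set) L. filterlim F (finite_subsets_at_top A) L \<Longrightarrow>
           ((\<lambda>i. \<Prod>x\<in>F i. f x ^ m x) \<longlongrightarrow> P) L"
proof -
  define N where "N = {x \<in> A. f x ^ m x = 0}"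
  define A' where "A' = {x \<in> A. f x ^ m x \<noteq> 0}"
  \<comment> \<open>Off this finite set a factor with \<open>m x > 0\<close> satisfies |f x - 1| <
    1/2, so |Ln (f x)| <= 2 |f x - 1|. Every vanishing factor lies in it, because there
    \<open>f x = 0\<close> and \<open>m x >= 1\<close>.\<close>
  define bad where "bad = {x \<in> A. real (m x) * norm (f x - 1) \<ge> 1 / 2}"
  have fin_bad: "finite bad"
  proof (rule ccontr)
    assume inf: "infinite bad"
    have "(\<lambda>x. real (m x) * norm (f x - 1)) summable_on bad"
      by (rule summable_on_subset_banach[OF assms]) (auto simp: bad_def)
    then have "(\<lambda>x. 1 / 2 :: real) summable_on bad"
      by (rule summable_on_comparison_test) (auto simp: bad_def)
    then show False using inf infsum_diverge_constant[of bad "1 / 2 :: real"] by simp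
  qed
  have "N \<subseteq> bad" by (auto simp: N_def bad_def)
  then have fin_N: "finite N" using fin_bad finite_subset by auto
  \<comment> \<open>The branch of the logarithm is irrelevant since only \<open>exp (c x)\<close>
    enters. Absolute summability of \<open>c\<close> makes the product of the nonzero factors
    converge to an exponential, hence to a nonzero limit.\<close>
  define c where "c = (\<lambda>x. of_nat (m x) * Ln (f x))"
  have exp_c: "exp (c x) = f x ^ m x" if "x \<in> A'" for x
    using that by (cases "m x = 0") (auto simp: c_def A'_def exp_of_nat_mult)
  have "(\<lambda>x. 2 * (real (m x) * norm (f x - 1))) summable_on A"
    using assms by (rule summable_on_cmult_right)
  then have "(\<lambda>x. 2 * (real (m x) * norm (f x - 1))) summable_on (A' - bad)"
    by (rule summable_on_subset_banach) (auto simp: A'_def)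
  then have "(\<lambda>x. norm (c x)) summable_on (A' - bad)"
  proof (rule summable_on_comparison_test)
    fix x assume x: "x \<in> A' - bad"
    show "norm (c x) \<le> 2 * (real (m x) * norm (f x - 1))"
    proof (cases "m x = 0")
      case False
      have "real (m x) * norm (f x - 1) < 1 / 2" using x by (auto simp: bad_def A'_def)
      moreover have "norm (f x - 1) \<le> real (m x) * norm (f x - 1)"
        using False by (simp add: mult_le_cancel_right1)
      ultimately have "norm (f x - 1) < 1 / 2" by simp
      then have "norm (Ln (1 + (f x - 1))) \<le> 2 * norm (f x - 1)"
        by (intro norm_Ln_le) auto
      then show ?thesis
        by (simp add: c_def norm_mult) (metis mult.left_commute mult_left_mono of_nat_0_le_iff)
    qed (auto simp: c_def)
  qed auto
  then have "c summable_on (A' - bad)" by (rule abs_summable_summable)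
  then have "c summable_on (A' - bad) \<union> (A' \<inter> bad)"
    using fin_bad by (subst summable_on_Un_disjoint) auto
  then have "c summable_on A'" by (simp add: Un_Diff_Int Un_commute Int_commute Diff_Int_distrib Un_Int_distrib2)
  then have "(sum c \<longlongrightarrow> infsum c A') (finite_subsets_at_top A')"
    using has_sum_infsum has_sum_def by blast
  then have "((\<lambda>F. exp (sum c F)) \<longlongrightarrow> exp (infsum c A')) (finite_subsets_at_top A')"
    by (intro tendsto_intros)
  then have lim: "((\<lambda>F. \<Prod>x\<in>F. f x ^ m x) \<longlongrightarrow> exp (infsum c A')) (finite_subsets_at_top A')"
  proof (rule Lim_transform_eventually)
    show "\<forall>\<^sub>F F in finite_subsets_at_top A'. exp (sum c F) = (\<Prod>x\<in>F. f x ^ m x)"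
      by (rule eventually_finite_subsets_at_top_weakI)
         (auto simp: exp_sum exp_c intro!: prod.cong)
  qed
  define P where "P = (\<Prod>x\<in>N. f x ^ m x) * exp (infsum c A')"
  show ?thesis
  proof
    show "has_prod_over (\<lambda>x. f x ^ m x) P A"
      unfolding has_prod_over_def
      using fin_N lim by (auto simp: N_def A'_def P_def intro!: exI[of _ "exp (infsum c A')"])
    fix F :: "'b \<Rightarrow> 'a set" and L assume F: "filterlim F (finite_subsets_at_top A) L"
    have FA: "eventually (\<lambda>i. finite (F i) \<and> F i \<subseteq> A) L"
      by (rule eventually_compose_filterlim[OF _ F])
         (auto intro: eventually_finite_subsets_at_top_weakI)
    \<comment> \<open>\<open>has_prod_over\<close> separates the vanishing factors, so an exhaustion
      of \<open>A\<close> is first cut down to \<open>A'\<close>. The finitely many indices in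
      \<open>N\<close> belong to \<open>F i\<close> eventually. This is what later allows the
      product to be evaluated along growing discs.\<close>
    have "filterlim (\<lambda>i. F i \<inter> A') (finite_subsets_at_top A') L"
      unfolding filterlim_finite_subsets_at_top
    proof (intro allI impI)
      fix X assume X: "finite X \<and> X \<subseteq> A'"
      then have "eventually (\<lambda>i. finite (F i) \<and> X \<subseteq> F i \<and> F i \<subseteq> A) L"
        using F unfolding filterlim_finite_subsets_at_top by (auto simp: A'_def)
      then show "\<forall>\<^sub>F i in L. finite (F i \<inter> A') \<and> X \<subseteq> F i \<inter> A' \<and> F i \<inter> A' \<subseteq> A'"
        by eventually_elim (use X in auto)
    qed
    then have "((\<lambda>i. \<Prod>x\<in>F i \<inter> A'. f x ^ m x) \<longlongrightarrow> exp (infsum c A')) L"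
      using lim by (rule filterlim_compose[rotated])
    then have "((\<lambda>i. (\<Prod>x\<in>N. f x ^ m x) * (\<Prod>x\<in>F i \<inter> A'. f x ^ m x)) \<longlongrightarrow> P) L"
      unfolding P_def by (intro tendsto_intros)
    moreover have "\<forall>\<^sub>F i in L. finite (F i) \<and> N \<subseteq> F i \<and> F i \<subseteq> A"
      using F fin_N unfolding filterlim_finite_subsets_at_top by (auto simp: N_def)
    then have "\<forall>\<^sub>F i in L. (\<Prod>x\<in>N. f x ^ m x) * (\<Prod>x\<in>F i \<inter> A'. f x ^ m x)
                 = (\<Prod>x\<in>F i. f x ^ m x)"
    proof eventually_elim
      case (elim i)
      have "F i = N \<union> (F i \<inter> A')" using elim by (auto simp: N_def A'_def)
      then have "(\<Prod>x\<in>F i. f x ^ m x) = (\<Prod>x\<in>N \<union> (F i \<inter> A'). f x ^ m x)" by simp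
      also have "\<dots> = (\<Prod>x\<in>N. f x ^ m x) * (\<Prod>x\<in>F i \<inter> A'. f x ^ m x)"
        using fin_N elim by (intro prod.union_disjoint) (auto simp: N_def A'_def)
      finally show ?case by simp
    qed
    ultimately show "((\<lambda>i. \<Prod>x\<in>F i. f x ^ m x) \<longlongrightarrow> P) L"
      by (rule Lim_transform_eventually)
  qed
qed

lemma has_prod_over_cong:
  assumes "\<And>x. x \<in> A \<Longrightarrow> f x = g x"
  shows "has_prod_over f P A \<longleftrightarrow> has_prod_over g P A"
proof -
  have zeros: "{x \<in> A. f x = 0} = {x \<in> A. g x = 0}" "{x \<in> A. f x \<noteq> 0} = {x \<in> A. g x \<noteq> 0}"
    using assms by auto
  have "(\<Prod>x\<in>{x \<in> A. g x = 0}. f x) = (\<Prod>x\<in>{x \<in> A. g x = 0}. g x)"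
    using assms by (intro prod.cong) auto
  moreover have "eventually (\<lambda>F. (\<Prod>x\<in>F. f x) = (\<Prod>x\<in>F. g x)) (finite_subsets_at_top {x \<in> A. g x \<noteq> 0})"
    using assms by (intro eventually_finite_subsets_at_top_weakI prod.cong) auto
  ultimately show ?thesis
    unfolding has_prod_over_def zeros by (simp add: tendsto_cong)
qed

section \<open>Dividing an entire function by finitely many normalized linear factors\<close>

lemma entire_divide_zero:
  assumes h: "h holomorphic_on UNIV" and nz: "h w \<noteq> 0" and a: "a \<noteq> 0"
  obtains g where "g holomorphic_on UNIV" "g a \<noteq> 0"
    "\<And>z. h z = g z * (1 - z / a) ^ nat (zorder h a)"
proof -
  define n where "n = nat (zorder h a)"
  obtain r where r: "r > 0" "zor_poly h a holomorphic_on cball a r"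
    and eq: "\<And>w. w \<in> cball a r \<Longrightarrow> h w = zor_poly h a w * (w - a) ^ n \<and> zor_poly h a w \<noteq> 0"
    using zorder_exist_zero[OF h open_UNIV connected_UNIV UNIV_I, of a] nz
    unfolding n_def by blast
  have split: "(w - a) ^ n = (- a) ^ n * (1 - w / a) ^ n" for w
    using a by (simp add: power_mult_distrib[symmetric] field_simps)
  \<comment> \<open>Near \<open>a\<close> the quotient is the local cofactor
    \<open>zor_poly\<close>, elsewhere the plain quotient. The constant \<open>(- a) ^ n\<close>
    converts (z - a)^n into (1 - z / a)^n, the form that equals 1 at the origin.\<close>
  define g where "g = (\<lambda>z. if z = a then zor_poly h a a * (- a) ^ n else h z / (1 - z / a) ^ n)"
  have g_ball: "g z = zor_poly h a z * (- a) ^ n" if "z \<in> ball a r" for z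
  proof (cases "z = a")
    case False
    then have "1 - z / a \<noteq> 0" using a by simp
    then show ?thesis using eq[of z] that False by (simp add: g_def split)
  qed (simp add: g_def)
  show ?thesis
  proof
    have "(\<lambda>z. zor_poly h a z * (- a) ^ n) holomorphic_on ball a r"
      by (intro holomorphic_intros holomorphic_on_subset[OF r(2)]) auto
    then have "g holomorphic_on ball a r"
      by (rule holomorphic_transform) (use g_ball in auto)
    moreover have "(\<lambda>z. h z / (1 - z / a) ^ n) holomorphic_on - {a}"
      using a by (intro holomorphic_intros holomorphic_on_subset[OF h]) auto
    then have "g holomorphic_on - {a}"
      by (rule holomorphic_transform) (auto simp: g_def)
    ultimately have "g holomorphic_on ball a r \<union> - {a}"
      by (intro holomorphic_on_Un) auto
    moreover have "ball a r \<union> - {a} = UNIV" using r by auto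
    ultimately show "g holomorphic_on UNIV" by simp
    show "g a \<noteq> 0" using eq[of a] r a by (simp add: g_def)
    show "h z = g z * (1 - z / a) ^ nat (zorder h a)" for z
    proof (cases "z = a")
      case True
      then show ?thesis using eq[of a] r by (cases "n = 0") (auto simp: g_def n_def)
    next
      case False
      then have "1 - z / a \<noteq> 0" using a by simp
      then show ?thesis using False by (simp add: g_def n_def)
    qed
  qed
qed

lemma entire_divide_zeros:
  assumes f: "f holomorphic_on UNIV" and f0: "f 0 \<noteq> 0" and "finite S" "0 \<notin> S"
  obtains h where "h holomorphic_on UNIV" "\<And>a. a \<in> S \<Longrightarrow> h a \<noteq> 0"
    "\<And>z. f z = h z * (\<Prod>a\<in>S. (1 - z / a) ^ nat (zorder f a))"
proof -
  have "\<exists>h. h holomorphic_on UNIV \<and> (\<forall>a\<in>S. h a \<noteq> 0) \<and>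
           (\<forall>z. f z = h z * (\<Prod>a\<in>S. (1 - z / a) ^ nat (zorder f a)))"
    using \<open>finite S\<close> \<open>0 \<notin> S\<close>
  proof (induction S rule: finite_induct)
    case empty
    show ?case using f by auto
  next
    case (insert a S)
    then obtain h where h: "h holomorphic_on UNIV" "\<And>b. b \<in> S \<Longrightarrow> h b \<noteq> 0"
      and eq: "\<And>z. f z = h z * (\<Prod>a\<in>S. (1 - z / a) ^ nat (zorder f a))"
      by auto
    define P where "P = (\<lambda>z. \<Prod>a\<in>S. (1 - z / a) ^ nat (zorder f a))"
    have f_eq: "f = (\<lambda>z. h z * P z)" using eq by (auto simp: P_def)
    have P: "P holomorphic_on UNIV" using insert.prems
      unfolding P_def by (intro holomorphic_intros) auto
    have Pa: "P a \<noteq> 0" using insert by (auto simp: P_def)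
    have h0: "h 0 \<noteq> 0" using f0 eq[of 0] by auto
    have "eventually (\<lambda>z. f z \<noteq> 0) (at a)"
      using non_zero_neighbour_alt[OF f open_UNIV connected_UNIV _ _ f0] by (auto elim: eventually_mono)
    \<comment> \<open>The exponent has to be the order of \<open>f\<close>, whereas the induction
      divides the partial quotient \<open>h\<close>. Both orders agree at \<open>a\<close> because
      the factors removed so far do not vanish there.\<close>
    then have "zorder f a = zorder h a + zorder P a"
      unfolding f_eq by (intro zorder_times_analytic) (use h(1) P in \<open>auto simp: analytic_on_open holomorphic_on_imp_analytic_at\<close>)
    also have "zorder P a = 0"
      by (rule zorder_eq_0I) (use P Pa in \<open>auto simp: holomorphic_on_imp_analytic_at\<close>)
    finally have order_eq: "zorder f a = zorder h a" by simp
    obtain g where g: "g holomorphic_on UNIV" "g a \<noteq> 0"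
      and hg: "\<And>z. h z = g z * (1 - z / a) ^ nat (zorder h a)"
      using entire_divide_zero[OF h(1) h0, of a] insert.prems by auto
    have "g b \<noteq> 0" if "b \<in> S" for b
      using h(2)[OF that] hg[of b] by auto
    then have "\<forall>b\<in>insert a S. g b \<noteq> 0" using g(2) by simp
    moreover have "f z = g z * (\<Prod>a\<in>insert a S. (1 - z / a) ^ nat (zorder f a))" for z
      unfolding eq[of z] hg[of z] using order_eq insert.hyps by simp
    ultimately show ?case using g(1) by blast
  qed
  then show ?thesis using that by blast
qed

section \<open>Growth of the zero-free quotient and counting of zeros\<close>

locale entire_of_finite_order =
  fixes f :: "complex \<Rightarrow> complex" and K :: real and p :: nat
  assumes hol: "f holomorphic_on UNIV" and f0: "f 0 \<noteq> 0"
    and growth: "\<And>z. norm (f z) \<le> exp (K * (1 + norm z) ^ p)"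
    and K_nonneg: "K \<ge> 0"
begin

definition m :: "complex \<Rightarrow> nat" where "m a = nat (zorder f a)"

definition Z :: "complex set" where "Z = {z. f z = 0}"

definition S :: "real \<Rightarrow> complex set" where "S R = {z \<in> Z. norm z < R}"

definition N :: "real \<Rightarrow> nat" where "N R = (\<Sum>a\<in>S R. m a)"

lemma zero_notin_Z [simp]: "0 \<notin> Z"
  using f0 by (simp add: Z_def)

lemma S_subset: "S R \<subseteq> Z" by (auto simp: S_def)

lemma zero_notin_S [simp]: "0 \<notin> S R"
  using S_subset zero_notin_Z by blast

lemma S_mono: "R \<le> R' \<Longrightarrow> S R \<subseteq> S R'"
  by (auto simp: S_def)

lemma finite_S: "finite (S R)"
proof (cases "Z = {}")
  case False
  then have "\<not> f constant_on UNIV"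
    using f0 unfolding constant_on_def Z_def by (metis (mono_tags, lifting) Collect_empty_eq UNIV_I)
  then have "finite {z \<in> cball 0 R. f z = 0}"
    by (intro holomorphic_compact_finite_zeros[OF hol]) auto
  then show ?thesis
    by (rule rev_finite_subset) (auto simp: S_def Z_def)
qed (simp add: S_def)

lemma quotient:
  obtains h where "h holomorphic_on UNIV" "\<And>z. norm z < R \<Longrightarrow> h z \<noteq> 0" "h 0 = f 0"
    "\<And>z. f z = h z * (\<Prod>a\<in>S R. (1 - z / a) ^ m a)"
proof -
  obtain h where h: "h holomorphic_on UNIV" "\<And>a. a \<in> S R \<Longrightarrow> h a \<noteq> 0"
    and eq: "\<And>z. f z = h z * (\<Prod>a\<in>S R. (1 - z / a) ^ m a)"
    using entire_divide_zeros[OF hol f0 finite_S[of R]] unfolding m_def by auto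
  have "h z \<noteq> 0" if "norm z < R" for z
  proof (cases "z \<in> S R")
    case False
    then have "f z \<noteq> 0" using that by (auto simp: S_def Z_def)
    then show ?thesis using eq[of z] by auto
  qed (use h in auto)
  moreover have "h 0 = f 0" using eq[of 0] by simp
  ultimately show ?thesis using that h eq by blast
qed

text \<open>On |w| = (c + 1) R each factor 1 - w / a with |a| < R has modulus at least c. With
  \<open>c = 1\<close> this bounds the quotient on |z| <= 2 R. With c > 1 the factor
  \<open>c ^ N R\<close> survives and turns the estimate into a Jensen-type bound on the number of
  zeros.\<close>

lemma quotient_bound:
  assumes h: "h holomorphic_on UNIV" and eq: "\<And>z. f z = h z * (\<Prod>a\<in>S R. (1 - z / a) ^ m a)"
    and "R > 0" "c \<ge> 1" and z: "norm z \<le> (c + 1) * R"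
  shows "norm (h z) * c ^ N R \<le> exp (K * (1 + (c + 1) * R) ^ p)"
proof -
  let ?M = "exp (K * (1 + (c + 1) * R) ^ p)"
  have "norm (h z) \<le> ?M / c ^ N R"
  proof (rule maximum_modulus_frontier[of h "cball 0 ((c + 1) * R)"])
    show "h holomorphic_on interior (cball 0 ((c + 1) * R))"
      using h by (rule holomorphic_on_subset) auto
    show "continuous_on (closure (cball 0 ((c + 1) * R))) h"
      using h by (intro holomorphic_on_imp_continuous_on holomorphic_on_subset[OF h]) auto
    fix w :: complex assume w: "w \<in> frontier (cball 0 ((c + 1) * R))"
    then have nw: "norm w = (c + 1) * R"
      using assms by (simp add: frontier_cball)
    have "c ^ m a \<le> norm ((1 - w / a) ^ m a)" if a: "a \<in> S R" for a
    proof -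
      have "a \<noteq> 0" "norm a < R" using a by (auto simp: S_def Z_def f0)
      then have "(c + 1) * norm a \<le> norm w"
        unfolding nw using assms by (intro mult_left_mono) auto
      then have "c + 1 \<le> norm (w / a)" using \<open>a \<noteq> 0\<close> by (simp add: norm_divide field_simps)
      also have "\<dots> \<le> norm (1 - w / a) + 1"
        using norm_triangle_ineq4[of 1 "1 - w / a"] by simp
      finally show ?thesis using assms by (simp add: norm_power power_mono)
    qed
    then have "(\<Prod>a\<in>S R. c ^ m a) \<le> (\<Prod>a\<in>S R. norm ((1 - w / a) ^ m a))"
      using assms by (intro prod_mono) auto
    then have "c ^ N R \<le> norm (\<Prod>a\<in>S R. (1 - w / a) ^ m a)"
      by (simp add: N_def power_sum prod_norm)
    then have "norm (h w) * c ^ N R \<le> norm (f w)"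
      unfolding eq[of w] norm_mult by (intro mult_left_mono) auto
    also have "\<dots> \<le> ?M" using growth[of w] by (simp add: nw)
    finally show "norm (h w) \<le> ?M / c ^ N R" using assms by (simp add: field_simps)
  qed (use z in auto)
  then show ?thesis using assms by (simp add: field_simps)
qed

text \<open>Evaluate the quotient at 0, where it equals \<open>f 0\<close>. The choice c = 3 >= e
  allows \<open>exp (N R)\<close> in place of \<open>c ^ N R\<close>, and (c + 1) R is the 4 R of
  the bound.\<close>

lemma zero_count: "R > 0 \<Longrightarrow> real (N R) \<le> K * (1 + 4 * R) ^ p - ln (norm (f 0))"
proof -
  assume R: "R > 0"
  obtain h where h: "h holomorphic_on UNIV" "h 0 = f 0"
    "\<And>z. f z = h z * (\<Prod>a\<in>S R. (1 - z / a) ^ m a)"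
    using quotient[of R] by metis
  have "norm (f 0) * exp 1 ^ N R \<le> norm (f 0) * 3 ^ N R"
    using exp_le by (intro mult_left_mono power_mono) auto
  also have "\<dots> \<le> exp (K * (1 + (3 + 1) * R) ^ p)"
    using quotient_bound[OF h(1,3) R, of 3 0] R h(2) by simp
  also have "norm (f 0) * exp 1 ^ N R = exp (ln (norm (f 0)) + real (N R))"
    using f0 by (simp add: exp_add exp_of_nat_mult[symmetric])
  finally show ?thesis by simp
qed

lemma zero_count': obtains C where "C \<ge> 0" "\<And>R. R \<ge> 1 \<Longrightarrow> real (N R) \<le> C * R ^ p"
proof
  \<comment> \<open>The 5 stems from 1 + 4 R <= 5 R for R >= 1.\<close>
  define C where "C = K * 5 ^ p + \<bar>ln (norm (f 0))\<bar>"
  show "C \<ge> 0" using K_nonneg by (simp add: C_def)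
  fix R :: real assume R: "R \<ge> 1"
  have "real (N R) \<le> K * (1 + 4 * R) ^ p + \<bar>ln (norm (f 0))\<bar> * 1"
    using zero_count[of R] R by linarith
  also have "\<dots> \<le> K * (5 * R) ^ p + \<bar>ln (norm (f 0))\<bar> * R ^ p"
    using R K_nonneg by (intro add_mono mult_left_mono power_mono one_le_power) auto
  finally show "real (N R) \<le> C * R ^ p" by (simp add: C_def algebra_simps power_mult_distrib)
qed

text \<open>Dyadic annuli: the zeros with 2^n <= |a| < 2^(n+1) number at most C 2^((n+1) p), so they
  contribute at most C 2^p 2^(-n).\<close>

lemma summable_zeros: "(\<lambda>a. real (m a) / norm a ^ Suc p) summable_on Z"
proof -
  define t where "t = (\<lambda>a. real (m a) / norm a ^ Suc p)"
  obtain C where C: "C \<ge> 0" "\<And>R. R \<ge> 1 \<Longrightarrow> real (N R) \<le> C * R ^ p"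
    using zero_count' by blast
  have bound: "sum t (S (2 ^ n)) \<le> sum t (S 1) + C * 2 ^ p * (\<Sum>k<n. (1 / 2) ^ k)" for n
  proof (induction n)
    case (Suc n)
    have sub: "S (2 ^ n) \<subseteq> S (2 ^ Suc n)" by (intro S_mono) simp
    have "sum t (S (2 ^ Suc n) - S (2 ^ n)) \<le> (\<Sum>a\<in>S (2 ^ Suc n) - S (2 ^ n). real (m a) / (2 ^ n) ^ Suc p)"
    proof (rule sum_mono)
      fix a assume a: "a \<in> S (2 ^ Suc n) - S (2 ^ n)"
      then have "2 ^ n \<le> norm a" by (auto simp: S_def)
      then have "(2 ^ n) ^ Suc p \<le> norm a ^ Suc p" by (intro power_mono) auto
      then show "t a \<le> real (m a) / (2 ^ n) ^ Suc p"
        unfolding t_def by (intro divide_left_mono) (auto intro!: mult_pos_pos zero_less_power less_le_trans[of 0 "2 ^ n" "norm a"] \<open>2 ^ n \<le> norm a\<close>)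
    qed
    also have "\<dots> \<le> (\<Sum>a\<in>S (2 ^ Suc n). real (m a) / (2 ^ n) ^ Suc p)"
      by (intro sum_mono2 finite_S) auto
    also have "\<dots> = real (N (2 ^ Suc n)) / (2 ^ n) ^ Suc p"
      by (simp add: N_def sum_divide_distrib)
    also have "\<dots> \<le> (C * (2 ^ Suc n) ^ p) / (2 ^ n) ^ Suc p"
      by (intro divide_right_mono C(2)) (auto simp: one_le_power simp del: power_Suc)
    also have "\<dots> = C * 2 ^ p * (1 / 2) ^ n"
      by (simp add: power_mult_distrib power_divide)
    finally have "sum t (S (2 ^ Suc n) - S (2 ^ n)) \<le> C * 2 ^ p * (1 / 2) ^ n" .
    then show ?case
      using Suc.IH sum.subset_diff[OF sub finite_S, of t] by (simp add: algebra_simps)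
  qed simp
  have "(\<Sum>k<n. (1 / 2 :: real) ^ k) \<le> 2" for n
    by (subst geometric_sum) auto
  then have "C * 2 ^ p * (\<Sum>k<n. (1 / 2) ^ k) \<le> C * 2 ^ p * 2" for n
    using C(1) by (intro mult_left_mono) auto
  then have bound': "sum t (S (2 ^ n)) \<le> sum t (S 1) + C * 2 ^ p * 2" for n
    using bound[of n] by (meson add_left_mono order_trans)
  have t_nonneg: "t a \<ge> 0" for a by (simp add: t_def)
  have "t summable_on Z"
  proof (rule nonneg_bounded_partial_sums_imp_summable_on)
    show "\<forall>\<^sub>F X in finite_subsets_at_top Z. sum t X \<le> sum t (S 1) + C * 2 ^ p * 2"
    proof (rule eventually_finite_subsets_at_top_weakI)
      fix X assume X: "finite X" "X \<subseteq> Z"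
      have "finite (norm ` X)" using X by simp
      then obtain b where b: "\<And>a. a \<in> X \<Longrightarrow> norm a \<le> b"
        by (metis bdd_above_finite bdd_above.E imageI)
      obtain n where n: "b < 2 ^ n" using real_arch_pow[of 2 b] by auto
      have "X \<subseteq> S (2 ^ n)" using X b n by (force simp: S_def)
      then have "sum t X \<le> sum t (S (2 ^ n))"
        using t_nonneg by (intro sum_mono2 finite_S) auto
      then show "sum t X \<le> sum t (S 1) + C * 2 ^ p * 2" using bound'[of n] by linarith
    qed
  qed (use t_nonneg in auto)
  then show ?thesis by (simp add: t_def)
qed

end

section \<open>Functions of the form 1 + O(u) at the origin, and polynomials vanishing to high order
  there\<close>

lemma bigo_one_plus_mult:
  fixes F G u :: "complex \<Rightarrow> complex"
  assumes F: "(\<lambda>s. F s - 1) \<in> O[at 0](u)" and G: "(\<lambda>s. G s - 1) \<in> O[at 0](u)"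
    and u: "u \<in> O[at 0](\<lambda>_. 1)"
  shows "(\<lambda>s. F s * G s - 1) \<in> O[at 0](u)"
proof -
  have "(\<lambda>s. (F s - 1) * (G s - 1)) \<in> O[at 0](\<lambda>s. u s * 1)"
    by (intro landau_o.big.mult F landau_o.big_trans[OF G u])
  then have "(\<lambda>s. (F s - 1) * (G s - 1) + (F s - 1) + (G s - 1)) \<in> O[at 0](u)"
    by (intro sum_in_bigo F G) simp
  then show ?thesis by (simp add: algebra_simps)
qed

lemma bigo_one_plus_power:
  fixes F u :: "complex \<Rightarrow> complex"
  assumes F: "(\<lambda>s. F s - 1) \<in> O[at 0](u)" and u: "u \<in> O[at 0](\<lambda>_. 1)"
  shows "(\<lambda>s. F s ^ n - 1) \<in> O[at 0](u)"
  by (induction n) (auto intro!: bigo_one_plus_mult F u)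

lemma bigo_one_plus_prod:
  fixes F :: "'a \<Rightarrow> complex \<Rightarrow> complex"
  assumes F: "\<And>i. i \<in> I \<Longrightarrow> (\<lambda>s. F i s - 1) \<in> O[at 0](u)" and u: "u \<in> O[at 0](\<lambda>_. 1)"
  shows "(\<lambda>s. (\<Prod>i\<in>I. F i s) - 1) \<in> O[at 0](u)"
  using F by (induction I rule: infinite_finite_induct) (auto intro!: bigo_one_plus_mult u)

lemma bigo_power_at_0: "(\<lambda>s :: complex. s ^ n) \<in> O[at 0](\<lambda>_. 1)"
proof (rule bigoI_tendsto[where c = "0 ^ n"])
  show "((\<lambda>s :: complex. s ^ n / 1) \<longlongrightarrow> 0 ^ n) (at 0)"
    by (auto intro!: tendsto_eq_intros)
qed auto

lemma tendsto_0_bigo: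
  fixes f u :: "'a \<Rightarrow> complex"
  assumes "f \<in> O[F](u)" and "(u \<longlongrightarrow> 0) F"
  shows "(f \<longlongrightarrow> 0) F"
proof -
  obtain c where c: "eventually (\<lambda>x. norm (f x) \<le> c * norm (u x)) F"
    using assms(1) by (elim landau_o.bigE)
  have "((\<lambda>x. c * norm (u x)) \<longlongrightarrow> c * norm (0 :: complex)) F"
    by (intro tendsto_intros assms(2))
  then show ?thesis by (intro Lim_null_comparison[OF c]) simp
qed

lemma bigo_exp_minus_one:
  fixes e u :: "complex \<Rightarrow> complex"
  assumes "e \<in> O[at 0](u)" and "(u \<longlongrightarrow> 0) (at 0)"
  shows "(\<lambda>s. exp (e s) - 1) \<in> O[at 0](u)"
proof -
  have "(e \<longlongrightarrow> 0) (at 0)"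
    using assms by (rule tendsto_0_bigo)
  then have "eventually (\<lambda>s. norm (e s) < 1 / 2) (at 0)"
    by (intro order_tendstoD(2)) (auto intro!: tendsto_eq_intros)
  then have "eventually (\<lambda>s. norm (exp (e s) - 1) \<le> 2 * norm (e s)) (at 0)"
  proof eventually_elim
    case (elim s)
    then have "norm (exp (e s) - 1 - e s) \<le> norm (e s) / 2"
      by (intro norm_exp_bounds_lemma) auto
    moreover have "norm (exp (e s) - 1) \<le> norm (exp (e s) - 1 - e s) + norm (e s)"
      using norm_triangle_ineq[of "exp (e s) - 1 - e s" "e s"] by simp
    ultimately show ?case using norm_ge_zero[of "e s"] by linarith
  qed
  then have "(\<lambda>s. exp (e s) - 1) \<in> O[at 0](e)"
    by (rule bigoI)
  then show ?thesis using assms(1) landau_o.big_trans by blast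
qed

text \<open>The converse of \<open>bigo_exp_minus_one\<close> needs e -> 0 in advance: exp (e) - 1
  is also small near the other multiples of 2 pi i.\<close>

lemma bigo_if_exp_minus_one:
  fixes e u :: "complex \<Rightarrow> complex"
  assumes "(e \<longlongrightarrow> 0) (at 0)" and "(\<lambda>s. exp (e s) - 1) \<in> O[at 0](u)"
  shows "e \<in> O[at 0](u)"
proof -
  have "eventually (\<lambda>s. norm (e s) < 1 / 2) (at 0)"
    using assms(1) by (intro order_tendstoD(2)) (auto intro!: tendsto_eq_intros)
  then have "eventually (\<lambda>s. norm (e s) \<le> 2 * norm (exp (e s) - 1)) (at 0)"
  proof eventually_elim
    case (elim s)
    then show ?case using norm_exp_bounds[of "e s"] by auto
  qed
  then have "e \<in> O[at 0](\<lambda>s. exp (e s) - 1)" by (rule bigoI)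
  then show ?thesis using assms(2) landau_o.big_trans by blast
qed

text \<open>Otherwise split off the exact power s^k with k <= degree P < n. The cofactor has a
  nonzero value at 0, yet would be O(s^(n - k)) and tend to 0.\<close>

lemma poly_eq_0_if_bigo:
  fixes P :: "complex poly"
  assumes "degree P < n" and "poly P \<in> O[at 0](\<lambda>s. s ^ n)"
  shows "P = 0"
proof (rule ccontr)
  assume "P \<noteq> 0"
  define k where "k = order 0 P"
  have "k \<le> degree P" unfolding k_def using \<open>P \<noteq> 0\<close> by (rule order_degree)
  then have kn: "k < n" using assms(1) by simp
  obtain Q where Q: "P = [:-0, 1:] ^ k * Q" "\<not> [:-0, 1:] dvd Q"
    using order_decomp[OF \<open>P \<noteq> 0\<close>, of 0] unfolding k_def by blast
  have "poly Q 0 \<noteq> 0" using Q(2) by (simp add: poly_eq_0_iff_dvd)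
  have QO: "(\<lambda>s. s ^ k * poly Q s) \<in> O[at 0](\<lambda>s. s ^ k * s ^ (n - k))"
    using assms(2) kn unfolding Q(1) poly_mult poly_power by (simp add: power_add[symmetric])
  have ev: "eventually (\<lambda>s :: complex. s ^ k \<noteq> 0) (at 0)"
    using eventually_neq_at_within[of 0] by eventually_elim simp
  have "poly Q \<in> O[at 0](\<lambda>s. s ^ (n - k))"
    by (rule landau_o.big.mult_cancel_left[OF bigtheta_refl ev, THEN iffD1, OF QO])
  moreover have "((\<lambda>s. s ^ (n - k)) \<longlongrightarrow> (0 :: complex)) (at 0)"
    using kn by (auto intro!: tendsto_eq_intros)
  ultimately have "(poly Q \<longlongrightarrow> 0) (at 0)" by (rule tendsto_0_bigo)
  moreover have "(poly Q \<longlongrightarrow> poly Q 0) (at 0)"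
    by (intro isContD poly_isCont)
  ultimately show False using \<open>poly Q 0 \<noteq> 0\<close> tendsto_unique[of "at 0"] by force
qed

section \<open>Local factorizations, their common polynomial, and the limit of large radius\<close>

context entire_of_finite_order
begin

text \<open>\<open>M\<close> is an upper bound for Re log (h / f 0), with h the quotient of f by its
  zeros in |a| < R; the summand 1 makes it strict, as Borel-Caratheodory demands.\<close>

lemma local_factorization:
  fixes R :: real
  assumes R: "R > 0"
  defines "M \<equiv> K * (1 + 2 * R) ^ p + \<bar>ln (norm (f 0))\<bar> + 1"
  obtains D e where "degree D \<le> p" "poly D 0 = 0"
    "\<And>s. norm s \<le> R / 4 \<Longrightarrow> norm (e s) \<le> 4 * M * (2 * norm s / R) ^ Suc p"
    "\<And>s. norm s \<le> R / 4 \<Longrightarrow>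
       f s = f 0 * (\<Prod>a\<in>S R. weierstrass_factor p (s / a) ^ m a) * exp (poly D s + e s)"
proof -
  obtain h where h: "h holomorphic_on UNIV" "\<And>z. norm z < R \<Longrightarrow> h z \<noteq> 0" "h 0 = f 0"
    "\<And>z. f z = h z * (\<Prod>a\<in>S R. (1 - z / a) ^ m a)"
    using quotient[of R] by metis
  have "(\<lambda>z. h z / f 0) holomorphic_on ball 0 R"
    using f0 by (intro holomorphic_intros holomorphic_on_subset[OF h(1)]) auto
  then obtain g0 where g0: "g0 holomorphic_on ball 0 R"
    "\<And>z. z \<in> ball 0 R \<Longrightarrow> exp (g0 z) = h z / f 0"
    using holomorphic_logarithm_exists[of "ball 0 R" "\<lambda>z. h z / f 0" 0] h(2) f0 R
    by (metis (no_types, lifting) convex_ball open_ball centre_in_ball divide_eq_0_iff mem_ball_0)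
  \<comment> \<open>A logarithm of h / f 0 is fixed only up to multiples of 2 pi i; this one
    vanishes at 0, as required for Borel-Caratheodory and for \<open>poly D 0 = 0\<close>.\<close>
  define g where "g = (\<lambda>z. g0 z - g0 0)"
  have g: "g holomorphic_on ball 0 R" "g 0 = 0"
    unfolding g_def by (intro holomorphic_intros g0) auto
  have exp_g: "exp (g z) = h z / f 0" if "norm z < R" for z
    using g0(2)[of z] g0(2)[of 0] that R f0 h(3) by (simp add: g_def exp_diff)
  have Re_g: "Re (g z) < M" if z: "z \<in> ball 0 R" for z
  proof -
    have "norm (h z) \<le> exp (K * (1 + 2 * R) ^ p)"
      using quotient_bound[OF h(1,4) R, of 1 z] z R by simp
    then have "exp (Re (g z)) \<le> exp (K * (1 + 2 * R) ^ p) / norm (f 0)"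
      using exp_g[of z] z by (simp add: norm_exp_eq_Re[symmetric] norm_divide divide_right_mono del: norm_exp_eq_Re)
    also have "\<dots> = exp (K * (1 + 2 * R) ^ p - ln (norm (f 0)))"
      using f0 by (simp add: exp_diff)
    finally show ?thesis by (simp add: M_def)
  qed
  have g_bound: "norm (g z) \<le> 2 * M" if "norm z \<le> R / 2" for z
    using borel_caratheodory_half_radius[OF g(1) R g(2) Re_g that] .
  define T where "T = (\<Sum>k\<le>p. monom ((deriv ^^ k) g 0 / fact k) k)"
  have poly_T: "poly T z = (\<Sum>k<Suc p. (deriv ^^ k) g 0 / fact k * z ^ k)" for z
    by (simp add: T_def poly_sum poly_monom lessThan_Suc_atMost)
  define e where "e = (\<lambda>s. g s - poly T s)"
  \<comment> \<open>\<open>Q\<close> collects the exponents in the Weierstrass factors. Replacing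
    the linear factors by Weierstrass factors multiplies the product by exp Q, so Q is subtracted
    from the Taylor polynomial \<open>T\<close>.\<close>
  define Q where "Q = (\<Sum>a\<in>S R. \<Sum>k=1..p. monom (of_nat (m a) / (a ^ k * of_nat k)) k)"
  have poly_Q: "poly Q z = (\<Sum>a\<in>S R. of_nat (m a) * (\<Sum>k=1..p. (z / a) ^ k / of_nat k))" for z
    by (simp add: Q_def poly_sum poly_monom sum_distrib_left power_divide)
  show ?thesis
  proof (rule that[of "T - Q" e])
    have "degree T \<le> p" unfolding T_def
      by (intro degree_sum_le) (auto intro: order_trans[OF degree_monom_le])
    moreover have "degree Q \<le> p" unfolding Q_def
      by (intro degree_sum_le finite_S) (auto intro: order_trans[OF degree_monom_le])
    ultimately show "degree (T - Q) \<le> p" by (rule degree_diff_le)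
    have "poly T 0 = g 0" by (simp add: poly_T lessThan_Suc_eq_insert_0 sum.reindex)
    moreover have "poly Q 0 = 0" unfolding poly_Q by (auto simp: power_0_left intro!: sum.neutral)
    ultimately show "poly (T - Q) 0 = 0" using g by simp
  next
    fix s :: complex assume s: "norm s \<le> R / 4"
    \<comment> \<open>Borel-Caratheodory gives |g| <= 2 M only on |z| <= R / 2. The Taylor estimate
      on that disc doubles the constant again and is valid up to half its radius, R / 4.\<close>
    have "norm (e s) \<le> 2 * (2 * M) * (norm s / (R / 2)) ^ Suc p"
      unfolding e_def poly_T
    proof (rule taylor_remainder_bound)
      show "g holomorphic_on ball 0 (R / 2)"
        by (rule holomorphic_on_subset[OF g(1)]) (use R in auto)
      show "continuous_on (cball 0 (R / 2)) g"
        by (rule holomorphic_on_imp_continuous_on, rule holomorphic_on_subset[OF g(1)]) (use R in auto)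
    qed (use R s g_bound in auto)
    then show "norm (e s) \<le> 4 * M * (2 * norm s / R) ^ Suc p" by (simp add: mult_ac)
    have "norm s < R" using s R by linarith
    then have hs: "h s = f 0 * exp (g s)" using exp_g[of s] f0 by (simp add: field_simps)
    have "exp (poly Q s) = (\<Prod>a\<in>S R. exp (\<Sum>k=1..p. (s / a) ^ k / of_nat k) ^ m a)"
      unfolding poly_Q exp_sum[OF finite_S] exp_of_nat_mult ..
    then have W: "(\<Prod>a\<in>S R. weierstrass_factor p (s / a) ^ m a)
        = (\<Prod>a\<in>S R. (1 - s / a) ^ m a) * exp (poly Q s)"
      by (simp only: weierstrass_factor_def power_mult_distrib prod.distrib)
    show "f s = f 0 * (\<Prod>a\<in>S R. weierstrass_factor p (s / a) ^ m a) * exp (poly (T - Q) s + e s)"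
      unfolding h(4)[of s] hs W by (simp add: e_def exp_diff exp_add)
  qed
qed

text \<open>The conclusion mentions only \<open>f\<close> and \<open>D\<close>: the radius has
  disappeared, and no logarithm of \<open>f\<close> has to be chosen. Both the Weierstrass factors
  and exp e_R are 1 + O(s^(p+1)).\<close>

lemma normal_form_at_0:
  fixes R :: real
  assumes R: "R > 0"
    and e: "\<And>s. norm s \<le> R / 4 \<Longrightarrow> norm (e s) \<le> M * (2 * norm s / R) ^ Suc p"
    and eq: "\<And>s. norm s \<le> R / 4 \<Longrightarrow>
       f s = f 0 * (\<Prod>a\<in>S R. weierstrass_factor p (s / a) ^ m a) * exp (poly D s + e s)"
  shows "(\<lambda>s. f s / f 0 * exp (- poly D s) - 1) \<in> O[at 0](\<lambda>s. s ^ Suc p)"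
proof -
  have near: "eventually (\<lambda>s :: complex. norm s < d) (at 0)" if "d > 0" for d
    using that by (intro order_tendstoD(2)) (auto intro!: tendsto_eq_intros)
  have R4: "R / 4 > 0" using R by simp
  have small: "((\<lambda>s :: complex. s ^ Suc p) \<longlongrightarrow> 0) (at 0)"
    by (auto intro!: tendsto_eq_intros)
  have "eventually (\<lambda>s. norm (e s) \<le> (M * (2 / R) ^ Suc p) * norm (s ^ Suc p)) (at 0)"
    using near[OF R4]
  proof eventually_elim
    case (elim s)
    then show ?case using e[of s] R
      by (simp add: norm_power power_divide power_mult_distrib norm_mult mult_ac)
  qed
  then have "e \<in> O[at 0](\<lambda>s. s ^ Suc p)" by (rule bigoI)
  then have E: "(\<lambda>s. exp (e s) - 1) \<in> O[at 0](\<lambda>s. s ^ Suc p)"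
    using small by (rule bigo_exp_minus_one)
  have W: "(\<lambda>s. weierstrass_factor p (s / a) - 1) \<in> O[at 0](\<lambda>s. s ^ Suc p)" if a: "a \<noteq> 0" for a
  proof (rule bigoI)
    have half: "norm a / 2 > 0" using a by simp
    show "eventually (\<lambda>s. norm (weierstrass_factor p (s / a) - 1)
            \<le> (3 / norm a ^ Suc p) * norm (s ^ Suc p)) (at 0)"
      using near[OF half]
    proof eventually_elim
      case (elim s)
      then have "norm (s / a) \<le> 1 / 2" using a by (simp add: norm_divide field_simps)
      from weierstrass_factor_bound[OF this, of p] show ?case
        by (simp add: norm_divide norm_power power_divide norm_mult)
    qed
  qed
  have "(\<lambda>s. (\<Prod>a\<in>S R. weierstrass_factor p (s / a) ^ m a) * exp (e s) - 1) \<in> O[at 0](\<lambda>s. s ^ Suc p)"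
    by (intro bigo_one_plus_mult[OF bigo_one_plus_prod[OF bigo_one_plus_power[OF W]] E] bigo_power_at_0)
       (use zero_notin_S in metis)
  moreover have ev: "eventually (\<lambda>s. (\<Prod>a\<in>S R. weierstrass_factor p (s / a) ^ m a) * exp (e s) - 1
                    = f s / f 0 * exp (- poly D s) - 1) (at 0)"
    using near[OF R4]
  proof eventually_elim
    case (elim s)
    then show ?case using f0 by (subst eq) (simp_all add: exp_add exp_minus)
  qed
  ultimately show ?thesis by (simp only: landau_o.big.in_cong[OF ev])
qed

text \<open>Hence the polynomial of \<open>local_factorization\<close> does not depend on the radius.\<close>

lemma normal_form_unique:
  fixes D D' :: "complex poly"
  assumes D: "degree D \<le> p" "poly D 0 = 0" "(\<lambda>s. f s / f 0 * exp (- poly D s) - 1) \<in> O[at 0](\<lambda>s. s ^ Suc p)"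
    and D': "degree D' \<le> p" "poly D' 0 = 0" "(\<lambda>s. f s / f 0 * exp (- poly D' s) - 1) \<in> O[at 0](\<lambda>s. s ^ Suc p)"
  shows "D = D'"
proof -
  let ?u = "\<lambda>s :: complex. s ^ Suc p"
  have cont: "isCont f 0"
    using hol by (meson UNIV_I continuous_on_eq_continuous_at holomorphic_on_imp_continuous_on open_UNIV)
  define G where "G = (\<lambda>s. f s / f 0 * exp (- poly D' s))"
  have "isCont G 0" unfolding G_def using cont f0 by (intro continuous_intros) auto
  moreover have "G 0 = 1" using D'(2) f0 by (simp add: G_def)
  ultimately have G1: "(G \<longlongrightarrow> 1) (at 0)" unfolding isCont_def by simp
  have "(\<lambda>s. (f s / f 0 * exp (- poly D s) - 1) - (G s - 1)) \<in> O[at 0](?u)"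
    using D(3) D'(3) unfolding G_def by (rule sum_in_bigo)
  moreover have "(\<lambda>s. inverse (G s)) \<in> O[at 0](\<lambda>_. 1)"
    using G1 by (intro bigoI_tendsto[where c = 1]) (auto intro!: tendsto_eq_intros)
  ultimately have "(\<lambda>s. ((f s / f 0 * exp (- poly D s) - 1) - (G s - 1)) * inverse (G s)) \<in> O[at 0](\<lambda>s. ?u s * 1)"
    by (rule landau_o.big.mult)
  moreover have "eventually (\<lambda>s. G s \<noteq> 0) (at 0)"
    using G1 by (rule tendsto_imp_eventually_ne) simp
  \<comment> \<open>The two normalized functions have quotient exp (D' - D), so their difference
    divided by \<open>G\<close> is exp (D' - D) - 1. As \<open>G\<close> tends to 1, the division
    preserves the order of vanishing.\<close>
  then have ev: "eventually (\<lambda>s. ((f s / f 0 * exp (- poly D s) - 1) - (G s - 1)) * inverse (G s)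
                = exp (poly (D' - D) s) - 1) (at 0)"
  proof eventually_elim
    case (elim s)
    then have "f s \<noteq> 0" by (auto simp: G_def)
    then show ?case using f0 by (simp add: G_def exp_diff exp_minus field_simps)
  qed
  ultimately have "(\<lambda>s. exp (poly (D' - D) s) - 1) \<in> O[at 0](?u)"
    by (simp only: landau_o.big.in_cong[OF ev] mult_1_right)
  moreover have "(poly (D' - D) \<longlongrightarrow> poly (D' - D) 0) (at 0)"
    by (intro isContD poly_isCont)
  ultimately have "poly (D' - D) \<in> O[at 0](?u)"
    using D(2) D'(2) by (auto intro: bigo_if_exp_minus_one[rotated])
  moreover have "degree (D' - D) < Suc p" using degree_diff_le[OF D'(1) D(1)] by simp
  ultimately have "D' - D = 0" by (rule poly_eq_0_if_bigo[rotated])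
  then show ?thesis by simp
qed

theorem hadamard_factorization:
  obtains q where "degree q \<le> p"
    "\<And>s. \<exists>P. has_prod_over (\<lambda>a. weierstrass_factor p (s / a) ^ m a) P Z \<and> f s = exp (poly q s) * P"
proof -
  define M where "M = (\<lambda>R. K * (1 + 2 * R) ^ p + \<bar>ln (norm (f 0))\<bar> + 1)"
  define good where "good = (\<lambda>R D e. degree D \<le> p \<and> poly D 0 = 0 \<and>
    (\<forall>s. norm s \<le> R / 4 \<longrightarrow> norm (e s) \<le> 4 * M R * (2 * norm s / R) ^ Suc p) \<and>
    (\<forall>s. norm s \<le> R / 4 \<longrightarrow>
       f s = f 0 * (\<Prod>a\<in>S R. weierstrass_factor p (s / a) ^ m a) * exp (poly D s + e s)))"
  have ex: "\<exists>D e. good R D e" if R: "R > 0" for R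
  proof -
    obtain D e where "degree D \<le> p" "poly D 0 = 0"
      "\<And>s. norm s \<le> R / 4 \<Longrightarrow>
         norm (e s) \<le> 4 * (K * (1 + 2 * R) ^ p + \<bar>ln (norm (f 0))\<bar> + 1) * (2 * norm s / R) ^ Suc p"
      "\<And>s. norm s \<le> R / 4 \<Longrightarrow>
         f s = f 0 * (\<Prod>a\<in>S R. weierstrass_factor p (s / a) ^ m a) * exp (poly D s + e s)"
      using local_factorization[OF R] by blast
    then have "good R D e" unfolding good_def M_def by blast
    then show ?thesis by blast
  qed
  \<comment> \<open>The radius 1 serves only to fix one polynomial \<open>D\<close>; by uniqueness
    it then works for every R > 0 with its own error term.\<close>
  have "\<exists>D e. good 1 D e" by (rule ex) simp
  then obtain D e1 where De1: "good 1 D e1" by (elim exE)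
  have nf: "(\<lambda>s. f s / f 0 * exp (- poly D' s) - 1) \<in> O[at 0](\<lambda>s. s ^ Suc p)"
    if "good R D' e" "R > 0" for R D' e
  proof (rule normal_form_at_0)
    show "R > 0" by fact
    show "norm (e s) \<le> 4 * M R * (2 * norm s / R) ^ Suc p" if "norm s \<le> R / 4" for s
      using \<open>good R D' e\<close> that unfolding good_def by blast
    show "f s = f 0 * (\<Prod>a\<in>S R. weierstrass_factor p (s / a) ^ m a) * exp (poly D' s + e s)"
      if "norm s \<le> R / 4" for s
      using \<open>good R D' e\<close> that unfolding good_def by blast
  qed
  have "\<exists>e. good R D e" if R: "R > 0" for R
  proof -
    obtain D' e where good: "good R D' e" using ex R by blast
    moreover have "D' = D"
      using De1 nf[OF De1 zero_less_one] good nf[OF good R] unfolding good_def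
      by (intro normal_form_unique) blast+
    ultimately show ?thesis by blast
  qed
  then have "\<forall>R. \<exists>e. R > 0 \<longrightarrow> good R D e" by blast
  from choice[OF this] obtain e where "\<forall>R. R > 0 \<longrightarrow> good R D (e R)" ..
  then have e: "good R D (e R)" if "R > 0" for R using that by blast
  have degree_D: "degree D \<le> p" using De1 unfolding good_def by blast
  have e_bound: "norm (e R s) \<le> 4 * M R * (2 * norm s / R) ^ Suc p"
    if "R > 0" "4 * norm s \<le> R" for R s
  proof -
    have "norm s \<le> R / 4" using that by simp
    then show ?thesis using e[OF \<open>R > 0\<close>] unfolding good_def by blast
  qed
  have e_eq: "f s = f 0 * (\<Prod>a\<in>S R. weierstrass_factor p (s / a) ^ m a) * exp (poly D s + e R s)"
    if "R > 0" "4 * norm s \<le> R" for R s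
  proof -
    have "norm s \<le> R / 4" using that by simp
    then show ?thesis using e[OF \<open>R > 0\<close>] unfolding good_def by blast
  qed
  \<comment> \<open>The constant coefficient absorbs the factor \<open>f 0\<close>.\<close>
  define q where "q = D + [:Ln (f 0):]"
  have exp_q: "exp (poly q s) = f 0 * exp (poly D s)" for s
    using f0 by (simp add: q_def exp_add)
  have S_lim: "filterlim S (finite_subsets_at_top Z) at_top"
    unfolding filterlim_finite_subsets_at_top
  proof (intro allI impI)
    fix X assume X: "finite X \<and> X \<subseteq> Z"
    then obtain b where b: "\<And>a. a \<in> X \<Longrightarrow> norm a \<le> b"
      by (metis bdd_above_finite bdd_above.E imageI finite_imageI)
    show "\<forall>\<^sub>F R in at_top. finite (S R) \<and> X \<subseteq> S R \<and> S R \<subseteq> Z"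
      using eventually_gt_at_top[of b]
    proof eventually_elim
      case (elim R)
      then show ?case using X b finite_S[of R] by (force simp: S_def)
    qed
  qed
  show ?thesis
  proof (rule that[of q])
    show "degree q \<le> p" unfolding q_def using degree_D by (intro degree_add_le) auto
    fix s :: complex
    have "(\<lambda>a. real (m a) * norm (weierstrass_factor p (s / a) - 1)) summable_on Z"
    proof -
      \<comment> \<open>Outside the finite set |a| < 2 |s| one has |s / a| <= 1/2, the range in
        which a Weierstrass factor differs from 1 by at most 3 |s / a|^(p+1).\<close>
      have "(\<lambda>a. (3 * norm s ^ Suc p) * (real (m a) / norm a ^ Suc p)) summable_on Z - S (2 * norm s)"
        by (rule summable_on_subset_banach[OF summable_on_cmult_right[OF summable_zeros]]) auto
      then have "(\<lambda>a. real (m a) * norm (weierstrass_factor p (s / a) - 1)) summable_on Z - S (2 * norm s)"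
      proof (rule summable_on_comparison_test)
        fix a assume a: "a \<in> Z - S (2 * norm s)"
        then have "a \<noteq> 0" using zero_notin_Z by auto
        moreover have "2 * norm s \<le> norm a" using a by (auto simp: S_def)
        ultimately have "norm (s / a) \<le> 1 / 2" by (simp add: norm_divide field_simps)
        from weierstrass_factor_bound[OF this, of p]
        have "real (m a) * norm (weierstrass_factor p (s / a) - 1) \<le> real (m a) * (3 * norm (s / a) ^ Suc p)"
          by (intro mult_left_mono) auto
        then show "real (m a) * norm (weierstrass_factor p (s / a) - 1)
               \<le> (3 * norm s ^ Suc p) * (real (m a) / norm a ^ Suc p)"
          by (simp add: norm_divide power_divide mult_ac)
      qed auto
      then have "(\<lambda>a. real (m a) * norm (weierstrass_factor p (s / a) - 1))
                   summable_on (Z - S (2 * norm s)) \<union> S (2 * norm s)"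
        using finite_S by (subst summable_on_Un_disjoint) auto
      then show ?thesis using S_subset by (simp add: Un_absorb2)
    qed
    then obtain P where P: "has_prod_over (\<lambda>a. weierstrass_factor p (s / a) ^ m a) P Z"
      and lim: "\<And>(F :: real \<Rightarrow> complex set) L. filterlim F (finite_subsets_at_top Z) L \<Longrightarrow>
           ((\<lambda>i. \<Prod>a\<in>F i. weierstrass_factor p (s / a) ^ m a) \<longlongrightarrow> P) L"
      by (rule has_prod_over_powI) blast
    have e_lim: "((\<lambda>R. e R s) \<longlongrightarrow> 0) at_top"
    proof (rule Lim_null_comparison)
      show "eventually (\<lambda>R. norm (e R s) \<le> 4 * M R * (2 * norm s / R) ^ Suc p) at_top"
        using eventually_ge_at_top[of "4 * norm s"] eventually_gt_at_top[of 0]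
        by eventually_elim (rule e_bound)
      \<comment> \<open>\<open>M R\<close> grows like R^p and is multiplied by R^(-p-1). The product
        is rewritten as a polynomial in 1 / R without constant term.\<close>
      have "((\<lambda>R :: real. (1 / R + 2) ^ p) \<longlongrightarrow> (0 + 2) ^ p) at_top"
        by (intro tendsto_intros) (auto intro!: tendsto_divide_0[OF tendsto_const] filterlim_at_top_imp_at_infinity filterlim_ident)
      moreover have inv_lim: "((\<lambda>R :: real. 1 / R) \<longlongrightarrow> 0) at_top"
        by (auto intro!: tendsto_divide_0[OF tendsto_const] filterlim_at_top_imp_at_infinity filterlim_ident)
      ultimately have "((\<lambda>R :: real. 4 * (2 * norm s) ^ Suc p *
          (K * ((1 / R + 2) ^ p * (1 / R)) + (\<bar>ln (norm (f 0))\<bar> + 1) * (1 / R) ^ Suc p))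
          \<longlongrightarrow> 4 * (2 * norm s) ^ Suc p * (K * ((0 + 2) ^ p * 0) + (\<bar>ln (norm (f 0))\<bar> + 1) * 0 ^ Suc p)) at_top"
        by (intro tendsto_mult tendsto_add tendsto_power tendsto_const)
      then have "((\<lambda>R :: real. 4 * (2 * norm s) ^ Suc p *
          (K * ((1 / R + 2) ^ p * (1 / R)) + (\<bar>ln (norm (f 0))\<bar> + 1) * (1 / R) ^ Suc p))
          \<longlongrightarrow> 0) at_top" by simp
      moreover have "eventually (\<lambda>R. 4 * (2 * norm s) ^ Suc p *
          (K * ((1 / R + 2) ^ p * (1 / R)) + (\<bar>ln (norm (f 0))\<bar> + 1) * (1 / R) ^ Suc p)
          = 4 * M R * (2 * norm s / R) ^ Suc p) at_top"
        using eventually_gt_at_top[of 0]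
      proof eventually_elim
        case (elim R)
        then have "1 / R + 2 = (1 + 2 * R) * (1 / R)" by (simp add: field_simps)
        then have A: "(1 / R + 2) ^ p * (1 / R) = (1 + 2 * R) ^ p * (1 / R) ^ Suc p"
          by (simp only: power_mult_distrib) simp
        have B: "(2 * norm s / R) ^ Suc p = (2 * norm s) ^ Suc p * (1 / R) ^ Suc p"
          by (simp only: power_mult_distrib[symmetric]) simp
        have C: "4 * X * (K * (Y * r) + L * r) = 4 * (K * Y + L) * (X * r)" for X Y L r :: real
          by (simp add: algebra_simps)
        show ?case unfolding M_def A B C add.assoc ..
      qed
      ultimately show "((\<lambda>R. 4 * M R * (2 * norm s / R) ^ Suc p) \<longlongrightarrow> 0) at_top"
        by (rule Lim_transform_eventually)
    qed
    have "((\<lambda>R. f 0 * (\<Prod>a\<in>S R. weierstrass_factor p (s / a) ^ m a) * exp (poly D s + e R s))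
             \<longlongrightarrow> f 0 * P * exp (poly D s + 0)) at_top"
      by (intro tendsto_intros lim[OF S_lim] e_lim)
    moreover have "eventually (\<lambda>R. f 0 * (\<Prod>a\<in>S R. weierstrass_factor p (s / a) ^ m a)
                      * exp (poly D s + e R s) = f s) at_top"
      using eventually_ge_at_top[of "4 * norm s"] eventually_gt_at_top[of 0]
    proof eventually_elim
      case (elim R)
      then show ?case using e_eq[of R s] by simp
    qed
    ultimately have "((\<lambda>_. f s) \<longlongrightarrow> f 0 * P * exp (poly D s + 0)) (at_top :: real filter)"
      by (rule Lim_transform_eventually)
    then have "f s = f 0 * P * exp (poly D s + 0)"
      by (simp add: tendsto_const_iff)
    then have "f s = exp (poly q s) * P" by (simp add: exp_q mult_ac)
    with P show "\<exists>P. has_prod_over (\<lambda>a. weierstrass_factor p (s / a) ^ m a) P Z \<and> f s = exp (poly q s) * P"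
      by blast
  qed
qed

end

section \<open>The infinite product with one factor removed\<close>

text \<open>The set \<open>E\<close> lets the full product (\<open>E = {}\<close>) and the product
  without its k-th factor (\<open>E = {k}\<close>) share their convergence, holomorphy and growth
  proofs.\<close>

definition qprod_except :: "nat set \<Rightarrow> complex \<Rightarrow> complex \<Rightarrow> complex" where
  "qprod_except E q w = (\<Prod>j. if j \<in> E then 1 else 1 - w * q ^ j)"

lemma qpochhammer_inf_eq: "qpochhammer_inf w q = qprod_except {} q w"
  by (simp add: qpochhammer_inf_def qprod_except_def)

context
  fixes q :: complex
  assumes q: "norm q < 1"
begin

lemma convergent_qprod_except: "convergent_prod (\<lambda>j. if j \<in> E then 1 else 1 - w * q ^ j)"
proof -
  have "summable (\<lambda>j. norm w * norm q ^ j)"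
    using q by (intro summable_mult summable_geometric) auto
  then have "summable (\<lambda>j. norm ((if j \<in> E then 1 else 1 - w * q ^ j) - 1))"
    by (rule summable_comparison_test') (auto simp: norm_mult norm_power)
  then have "abs_convergent_prod (\<lambda>j. if j \<in> E then 1 else 1 - w * q ^ j)"
    by (simp add: abs_convergent_prod_conv_summable)
  then show ?thesis by (rule abs_convergent_prod_imp_convergent_prod)
qed

lemma qprod_except_eq_0_iff: "qprod_except E q w = 0 \<longleftrightarrow> (\<exists>j. j \<notin> E \<and> w * q ^ j = 1)"
proof -
  have "(\<lambda>j. if j \<in> E then 1 else 1 - w * q ^ j) has_prod qprod_except E q w"
    unfolding qprod_except_def by (rule convergent_prod_has_prod[OF convergent_qprod_except])
  from has_prod_eq_0_iff[OF this]
  have "qprod_except E q w = 0 \<longleftrightarrow> (\<exists>j. 0 = (if j \<in> E then 1 else 1 - w * q ^ j))"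
    by (simp only: image_iff UNIV_I bex_simps simp_thms Bex_def)
  also have "\<dots> \<longleftrightarrow> (\<exists>j. j \<notin> E \<and> w * q ^ j = 1)" by (auto split: if_splits)
  finally show ?thesis .
qed

lemma qprod_except_split: "qprod_except {} q w = (1 - w * q ^ k) * qprod_except {k} q w"
proof -
  have single: "(\<lambda>j. if j = k then 1 - w * q ^ j else 1) has_prod (1 - w * q ^ k)"
    by (rule has_prod_single)
  have "(1 - w * q ^ k) * qprod_except {k} q w
      = (\<Prod>j. if j = k then 1 - w * q ^ j else 1) * (\<Prod>j. if j \<in> {k} then 1 else 1 - w * q ^ j)"
    using has_prod_unique[OF single] by (simp add: qprod_except_def)
  also have "\<dots> = (\<Prod>j. (if j = k then 1 - w * q ^ j else 1) * (if j \<in> {k} then 1 else 1 - w * q ^ j))"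
    by (rule prodinf_mult[OF _ convergent_qprod_except]) (use single in \<open>auto simp: has_prod_iff\<close>)
  also have "\<dots> = qprod_except {} q w"
    unfolding qprod_except_def by (intro prodinf_cong) auto
  finally show ?thesis ..
qed

lemma holomorphic_qprod_except: "qprod_except E q holomorphic_on UNIV"
proof -
  define P where "P = (\<lambda>N w. \<Prod>j<N. if j \<in> E then 1 else 1 - w * q ^ j)"
  have conv: "uniformly_convergent_on (cball 0 R) P" for R
    unfolding P_def
  proof (rule uniformly_convergent_on_prod')
    show "uniformly_convergent_on (cball 0 R)
            (\<lambda>N w. \<Sum>j<N. norm ((if j \<in> E then 1 else 1 - w * q ^ j) - 1))"
    proof (rule Weierstrass_m_test'_ev)
      show "\<forall>\<^sub>F n in sequentially. \<forall>w\<in>cball 0 R.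
              norm (norm ((if n \<in> E then 1 else 1 - w * q ^ n) - 1)) \<le> \<bar>R\<bar> * norm q ^ n"
        by (intro always_eventually allI ballI) (auto simp: norm_mult norm_power intro!: mult_right_mono)
      show "summable (\<lambda>n. \<bar>R\<bar> * norm q ^ n)"
        using q by (intro summable_mult summable_geometric) auto
    qed
    show "continuous_on (cball 0 R) (\<lambda>w. if n \<in> E then 1 else 1 - w * q ^ n)" for n
      by (cases "n \<in> E") (auto intro!: continuous_intros)
  qed auto
  have limit: "uniform_limit (cball 0 R) P (qprod_except E q) sequentially" for R
  proof -
    obtain g where g: "uniform_limit (cball 0 R) P g sequentially"
      using conv[of R] by (auto simp: uniformly_convergent_on_def)
    have "g w = qprod_except E q w" if "w \<in> cball 0 R" for w
    proof -
      \<comment> \<open>The shift reconciles partial products over j < N in \<open>P\<close> with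
        those over j <= n in the limit theorem for infinite products.\<close>
      have "(\<lambda>n. P (Suc n) w) \<longlonglongrightarrow> g w"
        using tendsto_uniform_limitI[OF g that] by (rule LIMSEQ_Suc)
      moreover have "(\<lambda>n. P (Suc n) w) \<longlonglongrightarrow> qprod_except E q w"
        using convergent_prod_LIMSEQ[OF convergent_qprod_except, of E w]
        unfolding P_def lessThan_Suc_atMost qprod_except_def .
      ultimately show ?thesis by (rule tendsto_unique[rotated]) simp
    qed
    then have "uniform_limit (cball 0 R) P g sequentially \<longleftrightarrow>
               uniform_limit (cball 0 R) P (qprod_except E q) sequentially"
      by (intro uniform_limit_cong) auto
    with g show ?thesis by simp
  qed
  show ?thesis
  proof (rule holomorphic_uniform_sequence)
    fix z :: complex
    have "uniform_limit (cball z 1) P (qprod_except E q) sequentially"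
      by (rule uniform_limit_on_subset[OF limit[of "norm z + 1"]]) (simp add: cball_subset_cball_iff)
    then show "\<exists>d>0. cball z d \<subseteq> UNIV \<and> uniform_limit (cball z d) P (qprod_except E q) sequentially"
      by (intro exI[of _ 1]) auto
    show "P n holomorphic_on UNIV" for n
      unfolding P_def
    proof (intro holomorphic_on_prod)
      show "(\<lambda>w. if j \<in> E then 1 else 1 - w * q ^ j) holomorphic_on UNIV" for j
        by (cases "j \<in> E") (auto intro!: holomorphic_intros)
    qed
  qed auto
qed

text \<open>The first N factors are at most 1 + |w| each. From index N on, |w q^(N+i)| <= |q|^i, so
  these factors are bounded by exp (|q|^i), whose exponents form a geometric series.\<close>

lemma norm_qprod_except_le:
  assumes N: "norm w * norm q ^ N \<le> 1"
  shows "norm (qprod_except E q w) \<le> (1 + norm w) ^ N * exp (1 / (1 - norm q))"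
proof (rule LIMSEQ_le_const2)
  have "(\<lambda>n. \<Prod>j\<le>n. if j \<in> E then 1 else 1 - w * q ^ j) \<longlonglongrightarrow> qprod_except E q w"
    unfolding qprod_except_def by (rule convergent_prod_LIMSEQ[OF convergent_qprod_except])
  then show "(\<lambda>n. norm (\<Prod>j\<le>n. if j \<in> E then 1 else 1 - w * q ^ j)) \<longlonglongrightarrow> norm (qprod_except E q w)"
    by (rule tendsto_norm)
  have "norm (\<Prod>j\<le>n. if j \<in> E then 1 else 1 - w * q ^ j) \<le> (1 + norm w) ^ N * exp (1 / (1 - norm q))" for n
  proof -
    define a where "a = (\<lambda>j. 1 + norm w * norm q ^ j)"
    have a0: "a j \<ge> 0" and a1: "a j \<ge> 1" for j by (auto simp: a_def)
    have "norm (\<Prod>j\<le>n. if j \<in> E then 1 else 1 - w * q ^ j) \<le> (\<Prod>j\<le>n. a j)"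
      unfolding prod_norm[symmetric]
    proof (intro prod_mono conjI norm_ge_zero)
      fix j
      show "norm (if j \<in> E then 1 else 1 - w * q ^ j) \<le> a j"
        using norm_triangle_ineq4[of 1 "w * q ^ j"] by (auto simp: a_def norm_mult norm_power)
    qed
    \<comment> \<open>Appending factors \<open>a j >= 1\<close> makes the range long enough to be
      split at N, even if n < N.\<close>
    also have "\<dots> \<le> (\<Prod>j<N + Suc n. a j)"
      using a1 by (intro prod_mono2) (auto intro: order_trans[OF zero_le_one])
    also have "\<dots> = (\<Prod>j<N. a j) * (\<Prod>i<Suc n. a (N + i))"
    proof -
      have "(\<Prod>j<N + m. a j) = (\<Prod>j<N. a j) * (\<Prod>i<m. a (N + i))" for m
        by (induction m) (auto simp: mult.assoc)
      then show ?thesis .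
    qed
    also have "\<dots> \<le> (1 + norm w) ^ N * exp (1 / (1 - norm q))"
    proof (intro mult_mono)
      have "(\<Prod>j<N. a j) \<le> (\<Prod>j<N. 1 + norm w)"
        using q by (intro prod_mono) (auto simp: a_def mult_left_le power_le_one intro!: add_nonneg_nonneg)
      then show "(\<Prod>j<N. a j) \<le> (1 + norm w) ^ N" by simp
      have "(\<Prod>i<Suc n. a (N + i)) \<le> (\<Prod>i<Suc n. exp (norm q ^ i))"
      proof (intro prod_mono conjI)
        fix i
        have "norm w * norm q ^ (N + i) = (norm w * norm q ^ N) * norm q ^ i"
          by (simp add: power_add)
        also have "\<dots> \<le> 1 * norm q ^ i" using N by (intro mult_right_mono) auto
        finally have "a (N + i) \<le> 1 + norm q ^ i" by (simp add: a_def)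
        also have "\<dots> \<le> exp (norm q ^ i)" by (rule exp_ge_add_one_self)
        finally show "a (N + i) \<le> exp (norm q ^ i)" .
      qed (use a1 order_trans zero_le_one in blast)
      also have "\<dots> = exp (\<Sum>i<Suc n. norm q ^ i)" by (simp add: exp_sum del: sum.lessThan_Suc prod.lessThan_Suc)
      also have "(\<Sum>i<Suc n. norm q ^ i) \<le> (\<Sum>i. norm q ^ i)"
        using q by (intro sum_le_suminf summable_geometric) auto
      also have "\<dots> = 1 / (1 - norm q)" using q by (intro suminf_geometric) auto
      finally show "(\<Prod>i<Suc n. a (N + i)) \<le> exp (1 / (1 - norm q))" by simp
    qed (use a0 in \<open>auto intro!: prod_nonneg simp del: prod.lessThan_Suc\<close>)
    finally show ?thesis .
  qed
  then show "\<exists>M. \<forall>n\<ge>M. norm (\<Prod>j\<le>n. if j \<in> E then 1 else 1 - w * q ^ j)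
                \<le> (1 + norm w) ^ N * exp (1 / (1 - norm q))"
    by blast
qed

end

text \<open>The rising factorial is compared factor by factor. The bound is the coefficient of x^k
  in (1 - x)^(-r), so the resulting majorant can be summed in closed form.\<close>

lemma norm_gbinomial_minus_le:
  fixes s :: complex
  assumes "norm s \<le> r"
  shows "norm ((- s) gchoose k) \<le> pochhammer r k / fact k"
proof -
  have "norm (s + of_nat i) \<le> r + of_nat i" for i
    using norm_triangle_ineq[of s "of_nat i"] assms by simp
  then have "norm (pochhammer s k) \<le> pochhammer r k"
    unfolding pochhammer_prod prod_norm[symmetric] by (intro prod_mono conjI norm_ge_zero)
  then show ?thesis
    by (simp add: gbinomial_pochhammer norm_mult norm_divide norm_power divide_right_mono)
qed

lemma pochhammer_fact_sums:
  assumes "0 \<le> x" "x < (1 :: real)"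
  shows "(\<lambda>k. pochhammer r k / fact k * x ^ k) sums (1 - x) powr (- r)"
proof -
  have "((- r) gchoose k) * (- x) ^ k = pochhammer r k / fact k * x ^ k" for k
  proof -
    have "(-1) ^ k * (-1) ^ k = (1 :: real)" by (simp add: power_mult_distrib[symmetric])
    then show ?thesis
      unfolding gbinomial_pochhammer power_minus[of x] by simp
  qed
  then show ?thesis using gen_binomial_real[of "- x" "- r"] assms by simp
qed

lemma mult_powers_sums:
  fixes a u :: "'a :: real_normed_field"
  assumes "norm u < 1"
  shows "(\<lambda>n. a * u ^ Suc n) sums (a * u / (1 - u))"
  using sums_mult[OF geometric_sums[OF assms], of "a * u"] by (simp add: mult_ac)

section \<open>The entire function and its growth\<close>

definition golden_c :: real where "golden_c = 1 / golden ^ 2"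

definition golden_q :: complex where "golden_q = - of_real (1 / golden ^ 2)"

definition golden_w :: "complex \<Rightarrow> complex" where "golden_w s = of_real golden powr (- s)"

text \<open>
  Since \<open>(-1)\<^sup>k \<phi>\<^bsup>-2k\<^esup> = q\<^sup>k\<close>, the \<open>k\<close>-th denominator of the series for \<open>Z\<^sub>F\<close> is
  \<open>\<phi>\<^bsup>s+2k\<^esup> (1 - \<phi>\<^bsup>-s\<^esup> q\<^sup>k)\<close>. Multiplication by \<open>(\<phi>\<^bsup>-s\<^esup>; q)\<^sub>\<infinity>\<close> cancels its second factor,
  which leaves a series of entire functions.
\<close>

definition xi_term :: "nat \<Rightarrow> complex \<Rightarrow> complex" where
  "xi_term k s = ((- s) gchoose k) * of_real golden_c ^ k * qprod_except {k} golden_q (golden_w s)"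

definition xi :: "complex \<Rightarrow> complex" where
  "xi s = 5 powr (s / 2) * golden_w s * (\<Sum>k. xi_term k s)"

text \<open>Here 1 + r bounds the number of large factors, and exp (1 + r ln phi) bounds each of
  them because 1 + |w| <= 2 phi^r <= e phi^r. The second exponential accounts for the tail.\<close>

definition qprod_bound :: "real \<Rightarrow> real" where
  "qprod_bound r = exp ((1 + r) * (1 + r * ln golden)) * exp (1 / (1 - golden_c))"

lemma golden_gt_1: "golden > 1"
  using real_less_rsqrt[of 1 5] by (simp add: golden_def)

lemma golden_c_bounds: "0 < golden_c" "golden_c < 1"
  using golden_gt_1 by (auto simp: golden_c_def one_less_power)

lemma norm_golden_q: "norm golden_q = golden_c"
  using golden_gt_1 by (simp add: golden_q_def golden_c_def norm_divide norm_power)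

lemma golden_q_eq: "golden_q = - of_real golden_c"
  by (simp add: golden_q_def golden_c_def)

lemma norm_golden_q_less: "norm golden_q < 1"
  using golden_c_bounds by (simp add: norm_golden_q)

lemma golden_w_nonzero [simp]: "golden_w s \<noteq> 0"
  using golden_gt_1 by (simp add: golden_w_def)

lemma norm_golden_w: "norm (golden_w s) = golden powr (- Re s)"
  using golden_gt_1 by (simp add: golden_w_def norm_powr_real_powr)

lemma norm_golden_w_le: "norm s \<le> r \<Longrightarrow> norm (golden_w s) \<le> golden powr r"
  unfolding norm_golden_w using golden_gt_1 abs_Re_le_cmod[of s] by (intro powr_mono) auto

lemma holomorphic_golden_w: "golden_w holomorphic_on A"
  unfolding golden_w_def using golden_gt_1 by (intro holomorphic_intros) auto

lemma norm_qprod_except_golden_le: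
  assumes s: "norm s \<le> r"
  shows "norm (qprod_except E golden_q (golden_w s)) \<le> qprod_bound r"
proof -
  have r: "r \<ge> 0" using s norm_ge_zero order_trans by blast
  \<comment> \<open>With 2 N >= r, |w| |q|^N <= phi^(r - 2 N) <= 1, the hypothesis on N in
    \<open>norm_qprod_except_le\<close>.\<close>
  define N where "N = nat \<lceil>r / 2\<rceil>"
  have N: "r \<le> 2 * real N" "real N \<le> 1 + r" unfolding N_def using r by linarith+
  define x where "x = golden powr r"
  have x1: "x \<ge> 1" unfolding x_def using golden_gt_1 r by (intro ge_one_powr_ge_zero) auto
  have x_exp: "x = exp (r * ln golden)" using golden_gt_1 by (simp add: x_def powr_def)
  have w: "norm (golden_w s) \<le> x" unfolding x_def using s by (rule norm_golden_w_le)
  have "golden powr (- (2 * real N)) = inverse (golden powr real (2 * N))"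
    by (simp add: powr_minus)
  also have "\<dots> = inverse (golden ^ (2 * N))"
    using golden_gt_1 powr_realpow[of golden "2 * N"] by (simp only: less_trans[OF zero_less_one])
  also have "\<dots> = golden_c ^ N"
    by (simp only: golden_c_def power_mult power_one_over inverse_eq_divide)
  finally have "golden_c ^ N = golden powr (- (2 * real N))" ..
  then have "norm (golden_w s) * norm golden_q ^ N \<le> x * golden powr (- (2 * real N))"
    using w by (simp add: norm_golden_q mult_right_mono)
  also have "\<dots> = golden powr (r - 2 * real N)"
    by (simp add: x_def powr_add[symmetric])
  also have "\<dots> \<le> golden powr 0" using golden_gt_1 N by (intro powr_mono) auto
  finally have "norm (golden_w s) * norm golden_q ^ N \<le> 1" using golden_gt_1 by simp
  from norm_qprod_except_le[OF norm_golden_q_less this, of E]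
  have "norm (qprod_except E golden_q (golden_w s)) \<le> (1 + norm (golden_w s)) ^ N * exp (1 / (1 - golden_c))"
    by (simp add: norm_golden_q)
  also have "(1 + norm (golden_w s)) ^ N \<le> exp (1 + r * ln golden) ^ N"
  proof (rule power_mono)
    have "1 + norm (golden_w s) \<le> 2 * x" using w x1 by simp
    also have "\<dots> \<le> exp 1 * x" using exp_ge_add_one_self[of 1] x1 by (intro mult_right_mono) auto
    finally show "1 + norm (golden_w s) \<le> exp (1 + r * ln golden)" by (simp add: x_exp exp_add)
  qed auto
  also have "\<dots> = exp (real N * (1 + r * ln golden))" by (simp add: exp_of_nat_mult)
  also have "\<dots> \<le> exp ((1 + r) * (1 + r * ln golden))"
    using N r golden_gt_1 by (auto intro!: mult_right_mono add_nonneg_nonneg)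
  finally show ?thesis by (simp add: qprod_bound_def)
qed

lemma norm_xi_term_le:
  assumes "norm s \<le> r"
  shows "norm (xi_term k s) \<le> qprod_bound r * (pochhammer r k / fact k * golden_c ^ k)"
proof -
  have "norm (xi_term k s) \<le> (pochhammer r k / fact k) * golden_c ^ k * qprod_bound r"
    unfolding xi_term_def norm_mult norm_power norm_of_real
    using norm_gbinomial_minus_le[OF assms, of k] norm_qprod_except_golden_le[OF assms, of "{k}"]
      golden_c_bounds order_trans[OF norm_ge_zero norm_gbinomial_minus_le[OF assms, of k]]
    by (intro mult_mono mult_nonneg_nonneg) auto
  then show ?thesis by (simp add: mult_ac)
qed

lemma xi_majorant_sums:
  "(\<lambda>k. qprod_bound r * (pochhammer r k / fact k * golden_c ^ k)) sums (qprod_bound r * (1 - golden_c) powr (- r))"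
  using golden_c_bounds by (intro sums_mult pochhammer_fact_sums) auto

lemma summable_xi_term: "summable (\<lambda>k. xi_term k s)"
  by (rule summable_comparison_test'[OF sums_summable[OF xi_majorant_sums]]) (rule norm_xi_term_le[OF order_refl])

lemma holomorphic_xi_term: "xi_term k holomorphic_on UNIV"
proof -
  have "(qprod_except {k} golden_q \<circ> golden_w) holomorphic_on UNIV"
    by (rule holomorphic_on_compose[OF holomorphic_golden_w])
       (rule holomorphic_on_subset[OF holomorphic_qprod_except[OF norm_golden_q_less]], simp)
  then have "(\<lambda>s. qprod_except {k} golden_q (golden_w s)) holomorphic_on UNIV"
    by (simp add: o_def)
  then show ?thesis
    unfolding xi_term_def gbinomial_pochhammer pochhammer_prod
    by (intro holomorphic_intros) auto
qed

lemma holomorphic_xi: "xi holomorphic_on UNIV"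
proof -
  have "(\<lambda>s. \<Sum>k. xi_term k s) holomorphic_on UNIV"
  proof (rule holomorphic_uniform_sequence)
    fix z :: complex
    have "uniform_limit (cball z 1) (\<lambda>n s. \<Sum>k<n. xi_term k s) (\<lambda>s. \<Sum>k. xi_term k s) sequentially"
    proof (rule Weierstrass_m_test)
      fix k s assume "s \<in> cball z 1"
      then have "norm s \<le> norm z + 1"
        using norm_triangle_sub[of s z] by (simp add: dist_norm norm_minus_commute)
      then show "norm (xi_term k s) \<le>
          qprod_bound (norm z + 1) * (pochhammer (norm z + 1) k / fact k * golden_c ^ k)"
        by (rule norm_xi_term_le)
    qed (rule sums_summable[OF xi_majorant_sums])
    then show "\<exists>d>0. cball z d \<subseteq> UNIV \<and>
        uniform_limit (cball z d) (\<lambda>n s. \<Sum>k<n. xi_term k s) (\<lambda>s. \<Sum>k. xi_term k s) sequentially"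
      by (intro exI[of _ 1]) auto
    show "(\<lambda>s. \<Sum>k<n. xi_term k s) holomorphic_on UNIV" for n
      by (intro holomorphic_intros holomorphic_xi_term)
  qed auto
  then show ?thesis
    unfolding xi_def by (intro holomorphic_intros holomorphic_golden_w) auto
qed

lemma xi_growth:
  obtains K where "K \<ge> 0" "\<And>s. norm (xi s) \<le> exp (K * (1 + norm s) ^ 2)"
proof
  \<comment> \<open>Each summand is the coefficient of one part of the exponent, after 1, r and the
    quadratic part have been replaced by multiples of (1 + r)^2.\<close>
  define K where "K = ln 5 / 2 + ln golden + (1 + ln golden) + 1 / (1 - golden_c) + (- ln (1 - golden_c))"
  have ln_pos: "ln golden > 0" "- ln (1 - golden_c) > 0"
    using golden_gt_1 golden_c_bounds by auto
  moreover have "1 / (1 - golden_c) > 0" "ln (5 :: real) > 0" using golden_c_bounds by auto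
  ultimately show "K \<ge> 0" unfolding K_def by linarith
  fix s :: complex
  define r where "r = norm s"
  have r: "r \<ge> 0" by (simp add: r_def)
  have "norm (\<Sum>k. xi_term k s) \<le> (\<Sum>k. qprod_bound r * (pochhammer r k / fact k * golden_c ^ k))"
    by (rule norm_suminf_le[OF norm_xi_term_le sums_summable[OF xi_majorant_sums]]) (simp add: r_def)
  also have "\<dots> = qprod_bound r * (1 - golden_c) powr (- r)"
    using xi_majorant_sums by (simp add: sums_iff)
  finally have sum_le: "norm (\<Sum>k. xi_term k s) \<le> qprod_bound r * (1 - golden_c) powr (- r)" .
  have "norm (5 powr (s / 2)) = 5 powr (Re s / 2)"
    using norm_powr_real_powr[of 5 "s / 2"] by simp
  also have "\<dots> \<le> 5 powr (r / 2)"
    using complex_Re_le_cmod[of s] by (intro powr_mono) (auto simp: r_def)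
  finally have five_le: "norm (5 powr (s / 2)) \<le> 5 powr (r / 2)" .
  have "norm (xi s) \<le> 5 powr (r / 2) * golden powr r * (qprod_bound r * (1 - golden_c) powr (- r))"
    unfolding xi_def norm_mult using five_le sum_le norm_golden_w_le[of s r]
    by (intro mult_mono) (auto simp: r_def)
  also have "\<dots> = exp (ln 5 / 2 * r + ln golden * r + (1 + r) * (1 + r * ln golden)
                     + 1 / (1 - golden_c) + (- ln (1 - golden_c)) * r)"
    using golden_gt_1 golden_c_bounds
    by (simp add: powr_def qprod_bound_def exp_add[symmetric] algebra_simps)
  also have "\<dots> \<le> exp (K * (1 + r) ^ 2)"
  proof (subst exp_le_cancel_iff)
    have sq: "r \<le> (1 + r)\<^sup>2" "1 \<le> (1 + r)\<^sup>2" using r by (auto simp: power2_eq_square algebra_simps)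
    have a: "ln 5 / 2 * r \<le> ln 5 / 2 * (1 + r)\<^sup>2" using sq by (intro mult_left_mono) auto
    have b: "ln golden * r \<le> ln golden * (1 + r)\<^sup>2" using sq ln_pos by (intro mult_left_mono) auto
    have "(1 + r) * (1 + r * ln golden) \<le> (1 + r) * ((1 + ln golden) * (1 + r))"
      using r ln_pos by (intro mult_left_mono) (auto simp: algebra_simps)
    then have c: "(1 + r) * (1 + r * ln golden) \<le> (1 + ln golden) * (1 + r)\<^sup>2"
      by (simp add: power2_eq_square mult_ac)
    have d: "1 / (1 - golden_c) * 1 \<le> 1 / (1 - golden_c) * (1 + r)\<^sup>2"
      using sq golden_c_bounds by (intro mult_left_mono) auto
    have e: "(- ln (1 - golden_c)) * r \<le> (- ln (1 - golden_c)) * (1 + r)\<^sup>2"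
      using sq ln_pos by (intro mult_left_mono) auto
    show "ln 5 / 2 * r + ln golden * r + (1 + r) * (1 + r * ln golden)
            + 1 / (1 - golden_c) + (- ln (1 - golden_c)) * r \<le> K * (1 + r)\<^sup>2"
      unfolding K_def distrib_right[of _ _ "(1 + r)\<^sup>2"] using a b c[unfolded distrib_right[of _ _ "(1 + r)\<^sup>2"]] d e by linarith
  qed
  finally show "norm (xi s) \<le> exp (K * (1 + norm s) ^ 2)" by (simp add: r_def)
qed

section \<open>The continued Dirichlet series\<close>

text \<open>Binet's formula with phi^n factored out: the conjugate root -1/phi is phi times
  q.\<close>

lemma fib_eq_golden: "real (fib n) = golden ^ n / sqrt 5 * (1 - (- golden_c) ^ n)"
proof -
  have "golden * ((sqrt 5 - 1) / 2) = 1"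
    by (simp add: golden_def algebra_simps)
  then have "1 / golden = (sqrt 5 - 1) / 2"
    using golden_gt_1 by (simp add: nonzero_divide_eq_eq mult.commute)
  then have conj: "(1 - sqrt 5) / 2 = - (1 / golden)" by simp
  have "real (fib n) = (golden ^ n - (- (1 / golden)) ^ n) / sqrt 5"
    using fib_closed_form[of n] unfolding conj golden_def[symmetric] by simp
  also have "(- (1 / golden)) ^ n = golden ^ n * (- golden_c) ^ n"
    unfolding power_mult_distrib[symmetric]
    using golden_gt_1 by (simp add: golden_c_def power2_eq_square)
  finally show ?thesis by (simp add: algebra_simps)
qed

text \<open>In Binet's form both phi^n / sqrt 5 and 1 - q^n are positive reals, so the complex power
  splits without a branch correction.\<close>

lemma fib_powr:
  "of_nat (fib (Suc n)) powr (- s) =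
     5 powr (s / 2) * golden_w s ^ Suc n * (1 - golden_q ^ Suc n) powr (- s)"
proof -
  define x where "x = golden ^ Suc n / sqrt 5"
  define y where "y = 1 - (- golden_c) ^ Suc n"
  have x: "x > 0" using golden_gt_1 by (simp add: x_def)
  have "\<bar>(- golden_c) ^ Suc n\<bar> = golden_c ^ Suc n"
    using golden_c_bounds by (simp only: power_abs abs_minus_cancel abs_of_pos)
  also have "\<dots> < 1" using golden_c_bounds by (intro power_Suc_less_one)
  finally have y: "y > 0" by (simp add: y_def)
  have "of_nat (fib (Suc n)) = (of_real x * of_real y :: complex)"
    using fib_eq_golden[of "Suc n"] unfolding x_def y_def
    by (metis of_real_mult of_real_of_nat_eq)
  then have "of_nat (fib (Suc n)) powr (- s) = of_real x powr (- s) * of_real y powr (- s)"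
    using x y by (simp add: powr_times_real)
  also have "of_real y = 1 - golden_q ^ Suc n"
    by (simp add: y_def golden_q_eq)
  also have "of_real x powr (- s) = exp (- s * of_real (ln x))"
    using x by (simp add: powr_def Ln_of_real)
  also have "ln x = real (Suc n) * ln golden - ln 5 / 2"
    using golden_gt_1 by (simp add: x_def ln_div ln_realpow ln_sqrt del: power_Suc)
  also have "exp (- s * of_real (real (Suc n) * ln golden - ln 5 / 2))
           = exp (s / 2 * of_real (ln 5)) * exp (of_nat (Suc n) * (- s * of_real (ln golden)))"
    by (simp add: exp_add[symmetric] algebra_simps)
  also have "exp (of_nat (Suc n) * (- s * of_real (ln golden))) = golden_w s ^ Suc n"
    using golden_gt_1 unfolding exp_of_nat_mult by (simp add: golden_w_def powr_def Ln_of_real)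
  also have "exp (s / 2 * of_real (ln 5)) = 5 powr (s / 2)"
    using Ln_of_real[of 5] by (simp add: powr_def)
  finally show ?thesis .
qed

lemma norm_golden_w_less: "Re s > 0 \<Longrightarrow> norm (golden_w s) < 1"
  unfolding norm_golden_w using golden_gt_1 powr_less_mono[of "- Re s" 0 golden] by simp

text \<open>Expand (1 - q^n)^(-s) binomially and interchange the summations: rows give the Dirichlet
  series, columns are geometric. The majorant \<open>T\<close> factors into a binomial series in k
  and a geometric series in n.\<close>

lemma fib_double_series:
  assumes s: "Re s > 0"
  defines "b \<equiv> \<lambda>k. ((- s) gchoose k) * of_real golden_c ^ k"
  shows "(\<lambda>n. golden_w s ^ Suc n * (1 - golden_q ^ Suc n) powr (- s)) sums
           (\<Sum>k. b k * (golden_w s / (1 - golden_w s * golden_q ^ k)))"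
proof -
  define w where "w = golden_w s"
  define t where "t = (\<lambda>(n, k). ((- s) gchoose k) * (- 1) ^ k * (w * golden_q ^ k) ^ Suc n)"
  have w: "norm w < 1" unfolding w_def using s by (rule norm_golden_w_less)
  have q_le: "norm (golden_q ^ k) \<le> 1" for k
    using norm_golden_q_less by (simp add: norm_power power_le_one)
  have wq: "norm (w * golden_q ^ k) < 1" for k
    using w q_le[of k] mult_left_le[of "norm (golden_q ^ k)" "norm w"] by (simp add: norm_mult)
  have q_pow: "norm (golden_q ^ Suc n) < 1" for n
    unfolding norm_power norm_golden_q using golden_c_bounds by (intro power_Suc_less_one)
  have minus_q: "(- 1) ^ k * golden_q ^ k = of_real golden_c ^ k" for k
    by (simp add: golden_q_eq power_mult_distrib[symmetric])
  define r where "r = norm s"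
  define T where "T = (\<lambda>(n, k). (pochhammer r k / fact k * golden_c ^ k) * norm w ^ Suc n)"
  have poch: "pochhammer r k / fact k \<ge> 0" for k
    using order_trans[OF norm_ge_zero norm_gbinomial_minus_le[of s r k]] by (simp add: r_def)
  have T_nonneg: "T x \<ge> 0" for x
    using poch golden_c_bounds by (auto simp: T_def split: prod.split intro!: mult_nonneg_nonneg simp del: power_Suc times_divide_eq_left)
  have "T summable_on (UNIV \<times> UNIV)"
  proof (rule summable_on_SigmaI)
    fix n :: nat
    have "(\<lambda>k. T (n, k)) sums ((1 - golden_c) powr (- r) * norm w ^ Suc n)"
      unfolding T_def prod.case using golden_c_bounds
      by (intro sums_mult2 pochhammer_fact_sums) auto
    moreover from this have "summable (\<lambda>k. norm (T (n, k)))"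
      using T_nonneg by (simp add: sums_iff)
    ultimately show "((\<lambda>k. T (n, k)) has_sum ((1 - golden_c) powr (- r) * norm w ^ Suc n)) UNIV"
      by (intro norm_summable_imp_has_sum)
  next
    have "summable (\<lambda>n. norm ((1 - golden_c) powr (- r) * norm w ^ Suc n))"
      using w by (simp add: norm_mult norm_power summable_mult summable_geometric)
    then show "(\<lambda>n. (1 - golden_c) powr (- r) * norm w ^ Suc n) summable_on UNIV"
      by (rule norm_summable_imp_summable_on)
  qed (rule T_nonneg)
  then have "(\<lambda>x. norm (t x)) summable_on (UNIV \<times> UNIV)"
  proof (rule summable_on_comparison_test)
    fix x :: "nat \<times> nat"
    obtain n k where x: "x = (n, k)" by (cases x)
    \<comment> \<open>Starting the exponents at 1 matters: one factor |q|^k must remain to provide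
      the decay in k.\<close>
    have "norm (golden_q ^ k) ^ Suc n \<le> golden_c ^ k"
    proof -
      have "norm (golden_q ^ k) ^ Suc n \<le> norm (golden_q ^ k) ^ 1"
        using q_le by (intro power_decreasing) auto
      then show ?thesis by (simp add: norm_power norm_golden_q)
    qed
    moreover have "norm ((- s) gchoose k) \<le> pochhammer r k / fact k"
      by (rule norm_gbinomial_minus_le) (simp add: r_def)
    ultimately have "norm ((- s) gchoose k) * (norm (golden_q ^ k) ^ Suc n * norm w ^ Suc n)
        \<le> (pochhammer r k / fact k) * (golden_c ^ k * norm w ^ Suc n)"
      using poch golden_c_bounds by (intro mult_mono mult_nonneg_nonneg) auto
    then show "norm (t x) \<le> T x"
      by (simp add: x t_def T_def norm_mult norm_power power_mult_distrib mult_ac del: power_Suc)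
  qed auto
  then have "t summable_on (UNIV \<times> UNIV)" by (rule abs_summable_summable)
  then obtain S where S: "(t has_sum S) (UNIV \<times> UNIV)" by (auto simp: summable_on_def)
  have row: "((\<lambda>k. t (n, k)) has_sum (w ^ Suc n * (1 - golden_q ^ Suc n) powr (- s))) UNIV" for n
  proof (rule norm_summable_imp_has_sum)
    have t_eq: "t (n, k) = w ^ Suc n * (((- s) gchoose k) * (- (golden_q ^ Suc n)) ^ k)" for k
    proof -
      have "(- (golden_q ^ Suc n)) ^ k = (- 1) ^ k * (golden_q ^ k) ^ Suc n"
        by (simp only: power_minus[of "golden_q ^ Suc n"] power_mult[symmetric] mult.commute)
      then show ?thesis by (simp only: t_def prod.case power_mult_distrib mult_ac)
    qed
    have "(\<lambda>k. ((- s) gchoose k) * (- (golden_q ^ Suc n)) ^ k) sums (1 + - (golden_q ^ Suc n)) powr (- s)"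
      using q_pow[of n] by (intro gen_binomial_complex) simp
    then show "(\<lambda>k. t (n, k)) sums (w ^ Suc n * (1 - golden_q ^ Suc n) powr (- s))"
      unfolding t_eq by (intro sums_mult) simp
    have "(\<lambda>x. norm (t x)) summable_on ((\<lambda>k. (n, k)) ` UNIV)"
      using \<open>(\<lambda>x. norm (t x)) summable_on (UNIV \<times> UNIV)\<close>
      by (rule summable_on_subset_banach) auto
    then have "(\<lambda>k. norm (t (n, k))) summable_on UNIV"
      by (subst (asm) summable_on_reindex) (auto simp: inj_on_def o_def)
    then show "summable (\<lambda>k. norm (t (n, k)))" by (rule summable_on_imp_summable)
  qed
  have col: "((\<lambda>n. t (n, k)) has_sum (b k * (w / (1 - w * golden_q ^ k)))) UNIV" for k
  proof (rule norm_summable_imp_has_sum)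
    have "(\<lambda>n. (((- s) gchoose k) * (- 1) ^ k) * (w * golden_q ^ k) ^ Suc n) sums
            ((((- s) gchoose k) * (- 1) ^ k) * (w * golden_q ^ k) / (1 - w * golden_q ^ k))"
      by (rule mult_powers_sums[OF wq])
    also have "(((- s) gchoose k) * (- 1) ^ k) * (w * golden_q ^ k) / (1 - w * golden_q ^ k)
             = ((- s) gchoose k) * ((- 1) ^ k * golden_q ^ k) * (w / (1 - w * golden_q ^ k))"
      by simp
    finally show "(\<lambda>n. t (n, k)) sums (b k * (w / (1 - w * golden_q ^ k)))"
      by (simp only: t_def prod.case minus_q b_def)
    have "summable (\<lambda>n. norm (((- s) gchoose k) * (- 1) ^ k) * norm (w * golden_q ^ k) ^ Suc n)"
      using mult_powers_sums[of "norm (w * golden_q ^ k)"] wq by (auto simp: sums_iff simp del: power_Suc)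
    then show "summable (\<lambda>n. norm (t (n, k)))"
      by (simp only: t_def prod.case norm_mult norm_power)
  qed
  have "((\<lambda>n. w ^ Suc n * (1 - golden_q ^ Suc n) powr (- s)) has_sum S) UNIV"
    by (rule has_sum_SigmaD[OF S]) (use row in auto)
  then have sums1: "(\<lambda>n. w ^ Suc n * (1 - golden_q ^ Suc n) powr (- s)) sums S"
    by (rule has_sum_imp_sums)
  have "((\<lambda>(k, n). t (n, k)) has_sum S) (UNIV \<times> UNIV)"
    using S by (subst (asm) has_sum_swap)
  then have "((\<lambda>k. b k * (w / (1 - w * golden_q ^ k))) has_sum S) UNIV"
    by (rule has_sum_SigmaD) (use col in auto)
  then have "(\<lambda>k. b k * (w / (1 - w * golden_q ^ k))) sums S"
    by (rule has_sum_imp_sums)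
  then show ?thesis using sums1 by (simp add: sums_iff w_def)
qed

definition golden_P :: "complex \<Rightarrow> complex" where
  "golden_P s = qpochhammer_inf (golden_w s) golden_q"

lemma golden_P_eq: "golden_P s = qprod_except {} golden_q (golden_w s)"
  by (simp add: golden_P_def qpochhammer_inf_eq)

lemma golden_P_eq_0_iff: "golden_P s = 0 \<longleftrightarrow> (\<exists>k. golden_w s * golden_q ^ k = 1)"
  unfolding golden_P_eq by (simp add: qprod_except_eq_0_iff[OF norm_golden_q_less])

lemma holomorphic_golden_P: "golden_P holomorphic_on UNIV"
proof -
  have "(qprod_except {} golden_q \<circ> golden_w) holomorphic_on UNIV"
    by (rule holomorphic_on_compose[OF holomorphic_golden_w])
       (rule holomorphic_on_subset[OF holomorphic_qprod_except[OF norm_golden_q_less]], simp)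
  then show ?thesis by (simp add: o_def golden_P_eq[abs_def])
qed

lemma golden_P_nonzero:
  assumes "Re s > 0" shows "golden_P s \<noteq> 0"
proof
  assume "golden_P s = 0"
  then obtain k where k: "golden_w s * golden_q ^ k = 1" by (auto simp: golden_P_eq_0_iff)
  have "norm (golden_w s) * norm golden_q ^ k \<le> norm (golden_w s) * 1"
    using norm_golden_q_less by (intro mult_left_mono power_le_one) auto
  moreover have "norm (golden_w s) * norm golden_q ^ k = 1"
    using arg_cong[OF k, of norm] by (simp add: norm_mult norm_power)
  ultimately show False using norm_golden_w_less[OF assms] by simp
qed

text \<open>On Re s > 0 the Pochhammer product has no zeros, so the missing factor can be restored:
  \<open>xi_term k s\<close> is \<open>golden_P s / golden_w s\<close> times the k-th column
  sum.\<close>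

lemma fib_dirichlet_series:
  assumes s: "Re s > 0"
  shows "(\<lambda>n. of_nat (fib (Suc n)) powr (- s)) sums (xi s / golden_P s)"
proof -
  define w where "w = golden_w s"
  have P: "golden_P s \<noteq> 0" using s by (rule golden_P_nonzero)
  have ne: "1 - w * golden_q ^ k \<noteq> 0" for k
    using P by (auto simp: golden_P_eq_0_iff w_def)
  have split: "qprod_except {k} golden_q w = golden_P s / (1 - w * golden_q ^ k)" for k
    using ne[of k] qprod_except_split[OF norm_golden_q_less, of w k]
    by (simp add: golden_P_eq w_def field_simps)
  have term_eq: "xi_term k s = golden_P s / w * (((- s) gchoose k) * of_real golden_c ^ k * (w / (1 - w * golden_q ^ k)))" for k
    by (simp add: xi_term_def w_def[symmetric] split) (simp add: w_def)
  have "summable (\<lambda>k. w / golden_P s * xi_term k s)"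
    by (intro summable_mult summable_xi_term)
  moreover have "w / golden_P s * xi_term k s = ((- s) gchoose k) * of_real golden_c ^ k * (w / (1 - w * golden_q ^ k))" for k
    using P unfolding term_eq by (simp add: w_def)
  ultimately have "(\<Sum>k. xi_term k s) = golden_P s / w *
      (\<Sum>k. ((- s) gchoose k) * of_real golden_c ^ k * (w / (1 - w * golden_q ^ k)))"
    unfolding term_eq by (subst suminf_mult) simp_all
  then have xi: "xi s / golden_P s = 5 powr (s / 2) *
      (\<Sum>k. ((- s) gchoose k) * of_real golden_c ^ k * (w / (1 - w * golden_q ^ k)))"
    using P by (simp add: xi_def w_def)
  show ?thesis
    unfolding fib_powr xi mult.assoc using sums_mult[OF fib_double_series[OF s], of "5 powr (s / 2)"]
    by (simp only: w_def mult.assoc)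
qed

text \<open>As |q|^j is strictly decreasing, w q^k = 1 holds for a single k. Every other term of the
  series still contains the vanishing factor 1 - w q^k.\<close>

lemma xi_nonzero:
  assumes "golden_P s = 0" shows "xi s \<noteq> 0"
proof -
  obtain k where k: "golden_w s * golden_q ^ k = 1"
    using assms by (auto simp: golden_P_eq_0_iff)
  have q0: "golden_q \<noteq> 0" "norm golden_q \<noteq> 1" using golden_gt_1 norm_golden_q_less by (auto simp: golden_q_def)
  have unique: "j = k" if "golden_w s * golden_q ^ j = 1" for j
  proof -
    have "golden_w s * golden_q ^ j = golden_w s * golden_q ^ k" using that k by simp
    then have "norm golden_q ^ j = norm golden_q ^ k" by (simp add: norm_power[symmetric])
    then show ?thesis using q0 norm_golden_q_less by (subst (asm) power_inject_exp') auto
  qed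
  have "xi_term j s = 0" if "j \<noteq> k" for j
    using that k by (auto simp: xi_term_def qprod_except_eq_0_iff[OF norm_golden_q_less])
  then have "(\<lambda>j. xi_term j s) sums xi_term k s"
    using sums_finite[of "{k}" "\<lambda>j. xi_term j s"] by auto
  then have sum_eq: "(\<Sum>j. xi_term j s) = xi_term k s" by (simp add: sums_iff)
  have "qprod_except {k} golden_q (golden_w s) \<noteq> 0"
    using unique by (auto simp: qprod_except_eq_0_iff[OF norm_golden_q_less])
  \<comment> \<open>The binomial coefficient vanishes only at s = -i with i < k, whereas |w q^k| = 1
    forces Re s = -2 k.\<close>
  moreover have "(- s) gchoose k \<noteq> 0"
  proof
    assume "(- s) gchoose k = 0"
    then have "pochhammer s k = 0" by (simp add: gbinomial_pochhammer)
    then obtain i where i: "i < k" "s = - of_nat i" by (auto simp: pochhammer_eq_0_iff)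
    have "norm (golden_w s) * norm golden_q ^ k = 1"
      using arg_cong[OF k, of norm] by (simp add: norm_mult norm_power)
    moreover have "norm (golden_w s) = golden ^ i"
      using golden_gt_1 by (simp add: norm_golden_w i powr_realpow)
    ultimately have "golden ^ i = (golden ^ 2) ^ k"
      using golden_gt_1 by (simp add: norm_golden_q golden_c_def power_one_over field_simps)
    then have "i = 2 * k" using golden_gt_1 by (simp add: power_mult[symmetric])
    then show False using i by simp
  qed
  moreover have "of_real golden_c \<noteq> (0 :: complex)" using golden_c_bounds by simp
  ultimately have "xi_term k s \<noteq> 0" by (simp add: xi_term_def)
  then show ?thesis by (simp add: xi_def sum_eq)
qed

section \<open>Uniqueness of the continuation, and its zeros and multiplicities\<close>

definition fib_quot :: "complex \<Rightarrow> complex" where "fib_quot s = xi s / golden_P s"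

lemma analytic_xi: "xi analytic_on {s}" and analytic_golden_P: "golden_P analytic_on {s}"
  using holomorphic_on_imp_analytic_at[OF holomorphic_xi open_UNIV]
    holomorphic_on_imp_analytic_at[OF holomorphic_golden_P open_UNIV] by auto

lemma meromorphic_fib_quot: "fib_quot meromorphic_on A"
proof -
  have "xi analytic_on UNIV" "golden_P analytic_on UNIV"
    using holomorphic_xi holomorphic_golden_P by (simp_all add: analytic_on_open)
  then have "(\<lambda>s. xi s / golden_P s) meromorphic_on UNIV"
    by (intro meromorphic_intros analytic_on_imp_meromorphic_on)
  then show ?thesis unfolding fib_quot_def[abs_def] by (rule meromorphic_on_subset) simp
qed

lemma analytic_fib_quot: "golden_P s \<noteq> 0 \<Longrightarrow> fib_quot analytic_on {s}"
  unfolding fib_quot_def[abs_def] by (intro analytic_intros analytic_xi analytic_golden_P) auto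

lemma eventually_golden_P_nonzero: "eventually (\<lambda>w. golden_P w \<noteq> 0) (at s)"
  using non_zero_neighbour_alt[OF holomorphic_golden_P open_UNIV connected_UNIV UNIV_I UNIV_I golden_P_nonzero[of 1]]
  by (auto elim: eventually_mono)

lemma eventually_zero_imp_remove_sings_zero:
  "eventually (\<lambda>w. f w = 0) (at z) \<Longrightarrow> remove_sings f z = 0"
  by (intro remove_sings_eqI tendsto_eventually)

text \<open>Where poles of f and g cancel, f - g may have the wrong value, so the identity theorem
  is applied to \<open>remove_sings\<close> of the difference. Equality near z then fixes the value
  at z: it is 0 at a pole and the limit otherwise.\<close>

lemma nicely_meromorphic_unique:
  assumes f: "f nicely_meromorphic_on UNIV" and g: "g nicely_meromorphic_on UNIV"
    and A: "open A" "a \<in> A" and eq: "\<And>z. z \<in> A \<Longrightarrow> f z = g z"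
  shows "f = g"
proof
  fix z :: complex
  define d where "d = (\<lambda>z. f z - g z)"
  have mero: "d meromorphic_on UNIV"
    using f g unfolding d_def nicely_meromorphic_on_def by (intro meromorphic_intros) auto
  have zero: "remove_sings d w = 0" if "w \<in> A" for w
  proof (rule eventually_zero_imp_remove_sings_zero)
    show "eventually (\<lambda>x. d x = 0) (at w)"
      using eventually_at_in_open'[OF A(1) that] by eventually_elim (simp add: d_def eq)
  qed
  \<comment> \<open>The alternative to vanishing identically is being nonzero off a sparse set,
    which is impossible near \<open>a\<close>.\<close>
  from nicely_meromorphic_imp_constant_or_avoid[OF remove_sings_nicely_meromorphic[OF mero] open_UNIV connected_UNIV, of 0]
  have all0: "remove_sings d w = 0" for w
  proof
    assume "\<forall>\<^sub>\<approx>x. remove_sings d x \<noteq> 0"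
    then have "eventually (\<lambda>x. remove_sings d x \<noteq> 0) (at a)"
      by (simp add: eventually_cosparse_open_eq)
    moreover have "eventually (\<lambda>x. x \<in> A) (at a)" using A by (rule eventually_at_in_open')
    ultimately have "eventually (\<lambda>x. False) (at a)" by eventually_elim (use zero in auto)
    then show ?thesis by simp
  qed auto
  have "isolated_singularity_at d z"
    using meromorphic_on_subset[OF mero, of "{z}"] by (simp add: meromorphic_at_iff)
  from eventually_remove_sings_eq_at[OF this]
  have ev: "eventually (\<lambda>w. f w = g w) (at z)"
    by eventually_elim (use all0 in \<open>simp add: d_def\<close>)
  show "f z = g z"
  proof (cases "is_pole f z")
    case True
    moreover from this have "is_pole g z" using is_pole_cong[OF ev refl] by simp
    ultimately show ?thesis using f g by (metis UNIV_I is_pole_zero_at_nicely_mero)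
  next
    case False
    then have "\<not> is_pole g z" using is_pole_cong[OF ev refl] by simp
    then have "(f \<longlongrightarrow> f z) (at z)" "(g \<longlongrightarrow> g z) (at z)"
      using f g False by (auto simp: nicely_meromorphic_on_def)
    moreover from this(2) have "(f \<longlongrightarrow> g z) (at z)"
      using tendsto_cong[OF ev] by simp
    ultimately show ?thesis using tendsto_unique[of "at z"] by auto
  qed
qed

lemma fib_zeta_eq: "fib_zeta = remove_sings fib_quot"
  unfolding fib_zeta_def
proof (rule the_equality, intro conjI allI impI)
  show nice: "remove_sings fib_quot nicely_meromorphic_on UNIV"
    by (rule remove_sings_nicely_meromorphic[OF meromorphic_fib_quot])
  show sums: "(\<lambda>n. of_nat (fib (Suc n)) powr (- s)) sums remove_sings fib_quot s" if "Re s > 0" for s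
    using fib_dirichlet_series[OF that] analytic_fib_quot[OF golden_P_nonzero[OF that]]
    by (simp add: fib_quot_def)
  fix Z assume Z: "Z nicely_meromorphic_on UNIV \<and> (\<forall>s. Re s > 0 \<longrightarrow> (\<lambda>n. of_nat (fib (Suc n)) powr (- s)) sums Z s)"
  show "Z = remove_sings fib_quot"
  proof (rule nicely_meromorphic_unique)
    show "open {s. Re s > 0}" by (rule open_halfspace_Re_gt)
    show "1 \<in> {s. Re s > 0}" by simp
    show "Z s = remove_sings fib_quot s" if "s \<in> {s. Re s > 0}" for s
      using that Z sums sums_unique2 by blast
  qed (use Z nice in auto)
qed

lemma eventually_fib_zeta_eq: "eventually (\<lambda>w. fib_zeta w = fib_quot w) (at s)"
  unfolding fib_zeta_eq
  by (rule eventually_remove_sings_eq_at) (use meromorphic_fib_quot[of "{s}"] in \<open>simp add: meromorphic_at_iff\<close>)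

text \<open>At the poles of \<open>fib_zeta\<close> the value of \<open>fib_Xi\<close> is a limit,
  and continuity of \<open>xi\<close> supplies it.\<close>

lemma fib_Xi_eq: "fib_Xi = xi"
proof
  fix s
  have "eventually (\<lambda>w. xi w = golden_P w * fib_zeta w) (at s)"
    using eventually_fib_zeta_eq[of s] eventually_golden_P_nonzero[of s] by eventually_elim (simp add: fib_quot_def)
  moreover have "(xi \<longlongrightarrow> xi s) (at s)"
    using analytic_xi[of s] by (intro isContD analytic_at_imp_isCont)
  ultimately have "((\<lambda>w. golden_P w * fib_zeta w) \<longlongrightarrow> xi s) (at s)"
    by (simp add: tendsto_cong)
  then show "fib_Xi s = xi s"
    unfolding fib_Xi_def golden_P_def golden_w_def golden_q_def by (rule remove_sings_eqI)
qed

lemma is_pole_fib_zeta: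
  assumes "golden_P s = 0" shows "is_pole fib_zeta s"
proof -
  have "filterlim golden_P (at 0) (at s)"
    using eventually_golden_P_nonzero[of s] analytic_golden_P[of s] assms
    by (auto simp: filterlim_at dest!: analytic_at_imp_isCont isContD)
  then have "is_pole fib_quot s"
    unfolding fib_quot_def[abs_def]
    using xi_nonzero[OF assms] analytic_at_imp_isCont[OF analytic_xi] by (intro is_pole_divide)
  then show ?thesis using is_pole_cong[OF eventually_fib_zeta_eq refl] by blast
qed

lemma fib_zeta_zeros_eq: "fib_zeta_zeros = {s. xi s = 0}"
proof -
  have "fib_zeta s = 0 \<and> \<not> is_pole fib_zeta s \<longleftrightarrow> xi s = 0" for s
  proof (cases "golden_P s = 0")
    \<comment> \<open>At a pole \<open>fib_zeta s\<close> is 0 by convention; the exclusion of poles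
      makes the left side false, in accordance with xi s <> 0.\<close>
    case True
    then show ?thesis using is_pole_fib_zeta xi_nonzero by auto
  next
    case False
    then have an: "fib_quot analytic_on {s}" by (rule analytic_fib_quot)
    then have "fib_zeta analytic_on {s}" unfolding fib_zeta_eq by (rule remove_sings_analytic_on)
    then have "\<not> is_pole fib_zeta s"
      using analytic_at_imp_no_pole by blast
    then show ?thesis using an False by (simp add: fib_zeta_eq fib_quot_def)
  qed
  then show ?thesis by (simp add: fib_zeta_zeros_def)
qed

text \<open>At s = 0 the factor with index 0 of the Pochhammer product is 1 - phi^0 = 0, so
  \<open>xi_nonzero\<close> supplies the normalization required for the factorization.\<close>

lemma xi_0: "xi 0 \<noteq> 0"
proof (rule xi_nonzero)
  have "golden_w 0 * golden_q ^ 0 = 1" using golden_gt_1 by (simp add: golden_w_def)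
  then show "golden_P 0 = 0" unfolding golden_P_eq_0_iff by blast
qed

lemma fib_zeta_mult_eq:
  assumes "xi s = 0" shows "fib_zeta_mult s = nat (zorder xi s)"
proof -
  have P: "golden_P s \<noteq> 0" using xi_nonzero assms by blast
  have "eventually (\<lambda>w. xi w \<noteq> 0) (at s)"
    using non_zero_neighbour_alt[OF holomorphic_xi open_UNIV connected_UNIV UNIV_I UNIV_I xi_0]
    by (auto elim: eventually_mono)
  then have "frequently (\<lambda>w. xi w \<noteq> 0) (at s)" by (intro eventually_frequently) auto
  moreover have "frequently (\<lambda>w. golden_P w \<noteq> 0) (at s)"
    using eventually_golden_P_nonzero by (intro eventually_frequently) auto
  ultimately have "zorder fib_quot s = zorder xi s - zorder golden_P s"
    unfolding fib_quot_def[abs_def]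
    using analytic_xi analytic_golden_P by (intro zorder_divide analytic_on_imp_meromorphic_on)
  also have "zorder golden_P s = 0" using analytic_golden_P P by (rule zorder_eq_0I)
  finally show ?thesis unfolding fib_zeta_mult_def using zorder_cong[OF eventually_fib_zeta_eq refl] by simp
qed

theorem mainTheorem12:
  shows "fib_Xi holomorphic_on UNIV
    \<and> (\<lambda>\<rho>. real (fib_zeta_mult \<rho>) / norm \<rho> ^ 3) summable_on fib_zeta_zeros
    \<and> (\<exists>A B C :: complex. \<forall>s :: complex. \<exists>P :: complex.
         has_prod_over
           (\<lambda>\<rho>. ((1 - s / \<rho>) * exp (s / \<rho> + s\<^sup>2 / (2 * \<rho>\<^sup>2))) ^ fib_zeta_mult \<rho>)
           P fib_zeta_zeros
         \<and> fib_Xi s = exp (A * s\<^sup>2 + B * s + C) * P)"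
proof -
  obtain K where "K \<ge> 0" "\<And>s. norm (xi s) \<le> exp (K * (1 + norm s) ^ 2)"
    using xi_growth by blast
  then interpret X: entire_of_finite_order xi K 2
    by unfold_locales (use holomorphic_xi xi_0 in auto)
  have Z: "fib_zeta_zeros = X.Z" by (simp add: fib_zeta_zeros_eq X.Z_def)
  have m: "fib_zeta_mult \<rho> = X.m \<rho>" if "\<rho> \<in> X.Z" for \<rho>
    using that fib_zeta_mult_eq by (simp add: X.Z_def X.m_def)
  have factor: "weierstrass_factor 2 (s / \<rho>) = (1 - s / \<rho>) * exp (s / \<rho> + s\<^sup>2 / (2 * \<rho>\<^sup>2))" for s \<rho>
    by (simp add: weierstrass_factor_def numeral_2_eq_2 power2_eq_square mult_ac)
  have "(\<lambda>\<rho>. real (fib_zeta_mult \<rho>) / norm \<rho> ^ 3) summable_on fib_zeta_zeros"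
    using X.summable_zeros unfolding Z
    by (subst summable_on_cong[where g = "\<lambda>\<rho>. real (X.m \<rho>) / norm \<rho> ^ Suc 2"]) (auto simp: m eval_nat_numeral)
  moreover have "\<exists>A B C :: complex. \<forall>s :: complex. \<exists>P :: complex.
         has_prod_over
           (\<lambda>\<rho>. ((1 - s / \<rho>) * exp (s / \<rho> + s\<^sup>2 / (2 * \<rho>\<^sup>2))) ^ fib_zeta_mult \<rho>)
           P fib_zeta_zeros
         \<and> fib_Xi s = exp (A * s\<^sup>2 + B * s + C) * P"
  proof -
    obtain q where q: "degree q \<le> 2"
      "\<And>s. \<exists>P. has_prod_over (\<lambda>\<rho>. weierstrass_factor 2 (s / \<rho>) ^ X.m \<rho>) P X.Z \<and> xi s = exp (poly q s) * P"
      using X.hadamard_factorization by blast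
    \<comment> \<open>The degree of q may be less than 2; the sum is padded with zero coefficients
      so that A, B and C can be read off in every case.\<close>
    have poly_q: "poly q s = coeff q 2 * s\<^sup>2 + coeff q 1 * s + coeff q 0" for s
    proof -
      have "poly q s = (\<Sum>i\<le>2. coeff q i * s ^ i)"
        unfolding poly_altdef using q(1) by (intro sum.mono_neutral_left) (auto simp: coeff_eq_0)
      then show ?thesis by (simp add: numeral_2_eq_2)
    qed
    have cong: "has_prod_over (\<lambda>\<rho>. ((1 - s / \<rho>) * exp (s / \<rho> + s\<^sup>2 / (2 * \<rho>\<^sup>2))) ^ fib_zeta_mult \<rho>) P fib_zeta_zeros
        \<longleftrightarrow> has_prod_over (\<lambda>\<rho>. weierstrass_factor 2 (s / \<rho>) ^ X.m \<rho>) P X.Z" for s P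
      unfolding Z by (intro has_prod_over_cong) (simp only: m factor)
    show ?thesis
    proof (rule exI[of _ "coeff q 2"], rule exI[of _ "coeff q 1"], rule exI[of _ "coeff q 0"], rule allI)
      fix s
      obtain P where "has_prod_over (\<lambda>\<rho>. weierstrass_factor 2 (s / \<rho>) ^ X.m \<rho>) P X.Z"
        and "xi s = exp (poly q s) * P"
        using q(2) by blast
      then show "\<exists>P. has_prod_over
             (\<lambda>\<rho>. ((1 - s / \<rho>) * exp (s / \<rho> + s\<^sup>2 / (2 * \<rho>\<^sup>2))) ^ fib_zeta_mult \<rho>) P fib_zeta_zeros
           \<and> fib_Xi s = exp (coeff q 2 * s\<^sup>2 + coeff q 1 * s + coeff q 0) * P"
        unfolding cong fib_Xi_eq poly_q by blast
    qed
  qed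
  ultimately show ?thesis using holomorphic_xi by (simp add: fib_Xi_eq)
qed

end
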